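(* Let $\mathcal{L}:M_n(\mathbb{C})\to[0,\infty)$ be a symmetric Lagrangian which is strictly convex, let $b>0$, and let $\mathcal{S}(\alpha)=\int_0^b\mathcal{L}(\dot\alpha(t))\,dt$. Let $Z$ be a Hermitian $n\times n$ matrix with $\|Z\|<\pi$, let $U\in\mathcal{U}(n)$ and $V=Ue^{iZ}$. Then the geodesic segment $\gamma:[0,b]\to\mathcal{U}(n)$, $\gamma(t)=Ue^{itZ/b}$, is the unique piecewise $C^1$ curve $[0,b]\to\mathcal{U}(n)$ joining $U$ to $V$ that minimizes $\mathcal{S}$ among all piecewise $C^1$ curves $\alpha:[0,b]\to\mathcal{U}(n)$ with $\alpha(0)=U$ and $\alpha(b)=V$; and $\mathcal{S}(\gamma)=b\,\mathcal{L}(Z/b)$.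
   Context: $M_n(\mathbb{C})$ is the algebra of complex $n\times n$ matrices, $\mathcal{H}(n)$ the real space of Hermitian matrices, $\mathcal{U}(n)$ the group of unitary matrices, $\|\cdot\|$ the spectral (operator) norm. A symmetric Lagrangian is a convex function $\mathcal{L}:M_n(\mathbb{C})\to[0,\infty)$ with $\mathcal{L}(0)=0$ and $\mathcal{L}(UAV)=\mathcal{L}(A)$ for all $A\in M_n(\mathbb{C})$ and all $U,V\in\mathcal{U}(n)$. $\mathcal{L}$ is strictly convex if, for $A,B\in\mathcal{H}(n)$, the equality $\mathcal{L}(\lambda A+(1-\lambda)B)=\lambda\mathcal{L}(A)+(1-\lambda)\mathcal{L}(B)$ for some $\lambda\in(0,1)$ implies $A=B$. A curve is piecewise $C^1$ if it is continuous and there is a finite partition of $[0,b]$ such that it is $C^1$ on each closed subinterval. *)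

theory Defs
  imports "HOL-Analysis.Analysis"
begin

text \<open>Matrices over the complex numbers have type \<^typ>\<open>complex^'n^'n\<close>. The norm and the topology of this
  type come from the Frobenius norm, and the operation \<open>*\<close> on it is entrywise; the matrix
  product is \<open>**\<close>, and for the same reason powers and the exponential are defined here.\<close>

definition ctranspose :: "complex^'n^'m \<Rightarrow> complex^'m^'n" where
  "ctranspose A = (\<chi> i j. cnj (A $ j $ i))"

definition hermitian :: "complex^'n^'n \<Rightarrow> bool" where
  "hermitian A \<longleftrightarrow> ctranspose A = A"

definition unitary :: "complex^'n^'n \<Rightarrow> bool" where
  "unitary U \<longleftrightarrow> ctranspose U ** U = mat 1 \<and> U ** ctranspose U = mat 1"

text \<open>The operator norm with respect to the Euclidean norm, which is the norm of \<^typ>\<open>complex^'n\<close>.\<close>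

definition spectral_norm :: "complex^'n^'n \<Rightarrow> real" where
  "spectral_norm A = onorm (\<lambda>x. A *v x)"

definition cscale :: "complex \<Rightarrow> complex^'n^'n \<Rightarrow> complex^'n^'n" where
  "cscale c A = (\<chi> i j. c * A $ i $ j)"

definition mpower :: "complex^'n^'n \<Rightarrow> nat \<Rightarrow> complex^'n^'n" where
  "mpower A k = (((**) A) ^^ k) (mat 1)"

definition mexp :: "complex^'n^'n \<Rightarrow> complex^'n^'n" where
  "mexp A = (\<Sum>k. mpower A k /\<^sub>R fact k)"

definition symmetric_lagrangian :: "(complex^'n^'n \<Rightarrow> real) \<Rightarrow> bool" where
  "symmetric_lagrangian L \<longleftrightarrow>
     (\<forall>A. 0 \<le> L A) \<and> convex_on UNIV L \<and> L 0 = 0 \<and>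
     (\<forall>A U V. unitary U \<longrightarrow> unitary V \<longrightarrow> L (U ** A ** V) = L A)"

text \<open>Strictness is required on Hermitian matrices only.\<close>

definition strictly_convex_lagrangian :: "(complex^'n^'n \<Rightarrow> real) \<Rightarrow> bool" where
  "strictly_convex_lagrangian L \<longleftrightarrow>
     (\<forall>A B. hermitian A \<longrightarrow> hermitian B \<longrightarrow>
        (\<exists>u::real. 0 < u \<and> u < 1 \<and>
           L (u *\<^sub>R A + (1 - u) *\<^sub>R B) = u * L A + (1 - u) * L B) \<longrightarrow>
        A = B)"

text \<open>Derivatives at the end points are one-sided. The library's
  \<^const>\<open>piecewise_C1_differentiable_on\<close> is weaker than the notion below: it
  allows the derivative to be unbounded near a break point.\<close>

definition C1_on_interval :: "(real \<Rightarrow> 'a::real_normed_vector) \<Rightarrow> real \<Rightarrow> real \<Rightarrow> bool" where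
  "C1_on_interval f a b \<longleftrightarrow>
     (\<exists>D. continuous_on {a..b} D \<and>
        (\<forall>t\<in>{a..b}. (f has_vector_derivative D t) (at t within {a..b})))"

definition piecewise_C1 :: "(real \<Rightarrow> 'a::real_normed_vector) \<Rightarrow> real \<Rightarrow> real \<Rightarrow> bool" where
  "piecewise_C1 f a b \<longleftrightarrow>
     continuous_on {a..b} f \<and>
     (\<exists>(m::nat) p. p 0 = a \<and> p m = b \<and>
        (\<forall>i<m. p i < p (Suc i) \<and> C1_on_interval f (p i) (p (Suc i))))"

text \<open>At the finitely many break points of a piecewise \<open>C\<^sup>1\<close> curve the value of
  \<^const>\<open>vector_derivative\<close> may be arbitrary; this does not affect the integral.\<close>

definition action :: "(complex^'n^'n \<Rightarrow> real) \<Rightarrow> real \<Rightarrow> (real \<Rightarrow> complex^'n^'n) \<Rightarrow> real" where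
  "action L b \<alpha> = integral {0..b} (\<lambda>t. L (vector_derivative \<alpha> (at t within {0..b})))"

text \<open>A curve on \<open>[0,b]\<close> is a function on all reals of which only the values on \<open>{0..b}\<close> matter.\<close>

definition unitary_curve ::
    "real \<Rightarrow> complex^'n^'n \<Rightarrow> complex^'n^'n \<Rightarrow> (real \<Rightarrow> complex^'n^'n) \<Rightarrow> bool" where
  "unitary_curve b U V \<alpha> \<longleftrightarrow>
     piecewise_C1 \<alpha> 0 b \<and> (\<forall>t\<in>{0..b}. unitary (\<alpha> t)) \<and> \<alpha> 0 = U \<and> \<alpha> b = V"

definition action_minimizer ::
    "(complex^'n^'n \<Rightarrow> real) \<Rightarrow> real \<Rightarrow> complex^'n^'n \<Rightarrow> complex^'n^'n
       \<Rightarrow> (real \<Rightarrow> complex^'n^'n) \<Rightarrow> bool" where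
  "action_minimizer L b U V \<alpha> \<longleftrightarrow>
     unitary_curve b U V \<alpha> \<and> (\<forall>\<beta>. unitary_curve b U V \<beta> \<longrightarrow> action L b \<alpha> \<le> action L b \<beta>)"

end

theory Submission
  imports Defs
begin

text \<open>
  Let \<open>\<alpha>\<close> be a unitary curve starting at the identity and \<open>\<theta>\<^sub>j(t)\<close> the arguments of the
  eigenvalues of \<open>\<alpha>(t)\<close>. Formally \<open>\<theta>\<^sub>j'\<close> is the diagonal of the velocity in an eigenbasis of
  \<open>\<alpha>(t)\<close>, so pinching gives \<open>L (diag \<theta>') \<le> L (\<alpha>')\<close>, and Jensen's inequality yields the lower
  bound. Eigenvalues need not be differentiable, so this is done for small finite steps:
  the vector of angles \<open>|\<theta>\<^sub>j|\<close> at the end of a step is bounded by the diagonal of a unitary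
  conjugate of the old one plus the velocity term, up to a quadratic error, and such
  diagonals do not increase a convex unitarily invariant function.

  For uniqueness, a subgradient at \<open>Z/b\<close> yields a second symmetric Lagrangian that touches
  \<open>L\<close> from below (up to a constant) only along the orbit of \<open>Z/b\<close>. Applying the lower bound to it
  shows that a minimizer has the same Frobenius speed as the geodesic. Each eigenvector \<open>\<xi>\<close> of
  \<open>Z\<close> then traces a curve \<open>\<beta>(t)\<xi>\<close> on the sphere, and the total energy of these curves
  forces all of them to be great circle arcs.
\<close>

section \<open>Unitary and diagonal matrices\<close>

text \<open>The lower bound is a limit of finite steps, so equality cannot be traced back through
  it. Uniqueness instead compares two Lagrangians: if \<open>N\<close> touches \<open>L\<close> from
  below at the geodesic velocity up to a constant, then \<open>L - N\<close> is minimal there, while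
  the lower bound holds for \<open>N\<close> along the competitor too. A nonnegative continuous
  function of the velocity then has integral at most 0 and vanishes on every smooth piece. The
  Frobenius speed is the right quantity to extract: it is constant on two-sided unitary orbits, and
  its square is the sum of the squared speeds of the curves traced by an orthonormal basis. The
  resulting total energy, the sum of \<open>(z j)^2 / b\<close>, is exactly the sum of the least
  energies of arcs of angle \<open>\<bar>z j\<bar>\<close>, so no single curve can waste any. The
  strict bound on the norm of \<open>Z\<close> enters twice: the gap between \<open>m\<close> and
  \<open>pi\<close> is the room for smoothing the angle function at \<open>-1\<close>, and
  \<open>sin (z j)\<close> is nonzero unless \<open>z j = 0\<close>, which makes the arc from
  \<open>u\<close> to \<open>cis (z j) *s u\<close> unique.\<close>

definition dg :: "complex^'n \<Rightarrow> complex^'n^'n" where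
  "dg x = (\<chi> i j. if i = j then x $ i else 0)"

lemma dg_nth [simp]: "dg x $ i $ j = (if i = j then x $ i else 0)"
  by (simp add: dg_def)

lemma ctranspose_nth [simp]: "ctranspose A $ i $ j = cnj (A $ j $ i)"
  by (simp add: ctranspose_def)

lemma ctranspose_ctranspose [simp]: "ctranspose (ctranspose A) = A"
  by (simp add: vec_eq_iff)

lemma matrix_mult_nth: "(A ** B) $ i $ j = (\<Sum>k\<in>UNIV. A $ i $ k * B $ k $ j)"
  by (simp add: matrix_matrix_mult_def)

lemma ctranspose_mult: "ctranspose (A ** B) = ctranspose B ** ctranspose A"
  by (simp add: vec_eq_iff matrix_mult_nth mult.commute)

lemma ctranspose_mat1 [simp]: "ctranspose (mat 1) = mat 1"
  by (simp add: vec_eq_iff mat_def)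

lemma ctranspose_dg: "ctranspose (dg x) = dg (\<chi> i. cnj (x $ i))"
  by (simp add: vec_eq_iff)

lemma ctranspose_diff: "ctranspose (A - B) = ctranspose A - ctranspose B"
  by (simp add: vec_eq_iff)

lemma dg_mult_nth [simp]: "(dg x ** A) $ i $ j = x $ i * A $ i $ j"
  by (simp add: matrix_mult_nth if_distrib[of "\<lambda>c. c * _"] sum.delta cong: if_cong)

lemma mult_dg_nth [simp]: "(A ** dg x) $ i $ j = A $ i $ j * x $ j"
  by (simp add: matrix_mult_nth if_distrib[of "\<lambda>c. _ * c"] sum.delta' cong: if_cong)

lemma dg_mult_dg: "dg x ** dg y = dg (\<chi> i. x $ i * y $ i)"
  by (simp add: vec_eq_iff)

lemma dg_one: "dg (\<chi> i. 1) = mat 1"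
  by (simp add: vec_eq_iff mat_def)

lemma dg_add: "dg (x + y) = dg x + dg y"
  by (simp add: vec_eq_iff)

lemma dg_scaleR: "dg (r *\<^sub>R x) = r *\<^sub>R dg x"
  by (simp add: vec_eq_iff)

lemma dg_inject [simp]: "dg x = dg y \<longleftrightarrow> x = y"
proof
  assume "dg x = dg y"
  then have "dg x $ i $ i = dg y $ i $ i" for i by simp
  then show "x = y" by (simp add: vec_eq_iff)
qed simp

lemma matrix_mult_scaleR_right: "A ** (r *\<^sub>R B) = r *\<^sub>R (A ** (B :: complex^'n^'m))"
  by (simp add: vec_eq_iff matrix_mult_nth scaleR_sum_right)

lemma matrix_mult_scaleR_left: "(r *\<^sub>R A) ** B = r *\<^sub>R (A ** (B :: complex^'n^'m))"
  by (simp add: vec_eq_iff matrix_mult_nth scaleR_sum_right)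

lemma matrix_add_rdistrib: "(A + B) ** C = A ** C + B ** (C :: complex^'n^'m)"
  by (simp add: vec_eq_iff matrix_mult_nth distrib_right sum.distrib)

lemma matrix_diff_rdistrib: "(A - B) ** C = A ** C - B ** (C :: complex^'n^'m)"
  by (simp add: vec_eq_iff matrix_mult_nth left_diff_distrib sum_subtractf)

lemma matrix_diff_ldistrib: "C ** (A - B) = C ** A - C ** (B :: complex^'n^'m)"
  by (simp add: vec_eq_iff matrix_mult_nth right_diff_distrib sum_subtractf)

lemma bounded_linear_matrix_mult_left: "bounded_linear (\<lambda>X :: complex^'n^'m. A ** X)"
  by (intro linear_conv_bounded_linear[THEN iffD1] linearI)
    (simp_all add: matrix_add_ldistrib matrix_mult_scaleR_right)

lemma bounded_linear_matrix_mult_right: "bounded_linear (\<lambda>X :: complex^'n^'m. X ** B)"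
  by (intro linear_conv_bounded_linear[THEN iffD1] linearI)
    (simp_all add: matrix_add_rdistrib matrix_mult_scaleR_left)

lemma bounded_bilinear_matrix_mult: "bounded_bilinear (\<lambda>A B :: complex^'n^'n. A ** B)"
  by (intro bilinear_conv_bounded_bilinear[THEN iffD1])
    (simp add: bilinear_def bounded_linear.linear[OF bounded_linear_matrix_mult_left]
      bounded_linear.linear[OF bounded_linear_matrix_mult_right])

lemma bounded_linear_dg: "bounded_linear dg"
  by (intro linear_conv_bounded_linear[THEN iffD1] linearI) (simp_all add: dg_add dg_scaleR)

lemma bounded_linear_ctranspose: "bounded_linear ctranspose"
  by (intro linear_conv_bounded_linear[THEN iffD1] linearI) (simp_all add: vec_eq_iff)

lemma bounded_linear_conj_dg: "bounded_linear (\<lambda>x. A ** dg x ** B)"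
  by (rule bounded_linear_compose[OF bounded_linear_matrix_mult_right
      bounded_linear_compose[OF bounded_linear_matrix_mult_left bounded_linear_dg]])

section \<open>Unitary matrices and the invariance of the Frobenius norm\<close>

lemma unitary_ctranspose: "unitary U \<Longrightarrow> unitary (ctranspose U)"
  by (simp add: unitary_def)

lemma unitary_mult:
  assumes "unitary U" "unitary V"
  shows "unitary (U ** V)"
proof -
  have "ctranspose V ** ctranspose U ** (U ** V) = ctranspose V ** (ctranspose U ** U) ** V"
    "U ** V ** (ctranspose V ** ctranspose U) = U ** (V ** ctranspose V) ** ctranspose U"
    by (simp_all add: matrix_mul_assoc)
  then show ?thesis
    using assms by (simp add: unitary_def ctranspose_mult)
qed

lemma unitary_mat1: "unitary (mat 1)"
  by (simp add: unitary_def)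

lemma unitary_dg:
  assumes "\<And>i. norm (x $ i) = 1"
  shows "unitary (dg x)"
proof -
  have "cnj (x $ i) * x $ i = 1" for i
    using assms[of i] by (simp add: complex_norm_square[symmetric] mult.commute[of "cnj _"])
  then show ?thesis
    by (simp add: unitary_def vec_eq_iff mat_def mult.commute)
qed

lemma unitary_cancel:
  assumes "unitary U"
  shows "ctranspose U ** (U ** A) = A" "U ** (ctranspose U ** A) = A"
    "A ** U ** ctranspose U = A" "A ** ctranspose U ** U = A"
  using assms unfolding unitary_def
  by (simp_all add: matrix_mul_assoc) (simp_all flip: matrix_mul_assoc)

lemma unitary_row:
  assumes "unitary U"
  shows "(\<Sum>k\<in>UNIV. (norm (U $ j $ k))\<^sup>2) = 1"
proof -
  have "(U ** ctranspose U) $ j $ j = 1"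
    using assms by (simp add: unitary_def mat_def)
  then have "(\<Sum>k\<in>UNIV. of_real ((norm (U $ j $ k))\<^sup>2)) = (1 :: complex)"
    by (simp add: matrix_mult_nth complex_norm_square del: of_real_power)
  then show ?thesis
    by (simp flip: of_real_sum del: of_real_power)
qed

lemma norm_matrix_sq: "(norm (A :: complex^'n^'m))\<^sup>2 = (\<Sum>i\<in>UNIV. \<Sum>j\<in>UNIV. (norm (A $ i $ j))\<^sup>2)"
  by (simp add: norm_vec_def L2_set_def sum_nonneg)

lemma norm_ctranspose: "norm (ctranspose A) = norm (A :: complex^'n^'m)"
proof -
  have "(norm (ctranspose A))\<^sup>2 = (norm A)\<^sup>2"
    unfolding norm_matrix_sq by (subst sum.swap) simp
  then show ?thesis by simp
qed

lemma norm_matrix_sq_trace: "of_real ((norm A)\<^sup>2) = trace (ctranspose A ** (A :: complex^'n^'n))"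
  unfolding norm_matrix_sq trace_def matrix_mult_nth
  by (subst sum.swap) (simp add: complex_norm_square mult.commute del: of_real_power)

lemma norm_unitary_mult:
  fixes A :: "complex^'n^'n"
  assumes "unitary U"
  shows "norm (U ** A) = norm A"
proof -
  have "ctranspose (U ** A) ** (U ** A) = ctranspose A ** A"
    using unitary_cancel(1)[OF assms, of A] by (simp add: ctranspose_mult flip: matrix_mul_assoc)
  then have "(norm (U ** A))\<^sup>2 = (norm A)\<^sup>2"
    by (metis norm_matrix_sq_trace of_real_eq_iff)
  then show ?thesis by simp
qed

lemma norm_mult_unitary:
  fixes A :: "complex^'n^'n"
  assumes "unitary U"
  shows "norm (A ** U) = norm A"
  by (metis norm_unitary_mult[OF unitary_ctranspose[OF assms]] ctranspose_mult norm_ctranspose)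

lemma norm_dg: "norm (dg x) = norm x"
proof -
  have "(norm (dg x))\<^sup>2 = (norm x)\<^sup>2"
    unfolding norm_matrix_sq
    by (simp add: norm_vec_def L2_set_def sum_nonneg if_distrib[of "\<lambda>z. (norm z)\<^sup>2"] cong: if_cong)
  then show ?thesis by simp
qed

lemma inner_matrix: "(A :: complex^'n^'m) \<bullet> B = Re (\<Sum>i\<in>UNIV. \<Sum>j\<in>UNIV. cnj (A $ i $ j) * B $ i $ j)"
  by (simp add: inner_vec_def inner_complex_def)

section \<open>The spectral theorem for normal matrices\<close>

text \<open>A maximizer \<open>x\<close> of the Rayleigh quotient on the unit sphere of
  \<open>S\<close> is an eigenvector, because its residual \<open>r = T x - \<mu> x\<close> lies in
  \<open>S\<close> and would otherwise be a direction of increase. The setting is real, so that it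
  applies to \<open>complex^'n\<close> with its real inner product.\<close>

lemma selfadjoint_eigenvector:
  fixes T :: "'a::euclidean_space \<Rightarrow> 'a"
  assumes T: "linear T" and S: "subspace S" and inv: "\<And>x. x \<in> S \<Longrightarrow> T x \<in> S"
    and sym: "\<And>x y. x \<bullet> T y = T x \<bullet> y"
    and nz: "z \<in> S" "z \<noteq> 0"
  obtains x \<mu> where "x \<in> S" "norm x = 1" "T x = \<mu> *\<^sub>R x"
proof -
  interpret T: linear T by (fact T)
  have "compact (S \<inter> sphere 0 1)"
    using closed_subspace[OF S] by (intro closed_Int_compact) auto
  moreover have "z /\<^sub>R norm z \<in> S \<inter> sphere 0 1"
    using nz S by (simp add: subspace_scale)
  moreover have "continuous_on (S \<inter> sphere 0 1) (\<lambda>x. x \<bullet> T x)"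
    by (intro continuous_intros linear_continuous_on linear_conv_bounded_linear[THEN iffD1] T)
  ultimately obtain x where "x \<in> S \<inter> sphere 0 1"
    and "\<forall>y\<in>S \<inter> sphere 0 1. y \<bullet> T y \<le> x \<bullet> T x"
    using continuous_attains_sup[of "S \<inter> sphere 0 1" "\<lambda>x. x \<bullet> T x"] by blast
  then have x: "x \<in> S" "norm x = 1"
    and max: "\<And>y. y \<in> S \<Longrightarrow> norm y = 1 \<Longrightarrow> y \<bullet> T y \<le> x \<bullet> T x"
    by auto
  define \<mu> where "\<mu> = x \<bullet> T x"
  have quad: "y \<bullet> T y \<le> \<mu> * (y \<bullet> y)" if "y \<in> S" for y
  proof (cases "y = 0")
    case False
    have "(y /\<^sub>R norm y) \<bullet> T (y /\<^sub>R norm y) \<le> \<mu>"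
      unfolding \<mu>_def using False that S by (intro max) (auto simp: subspace_scale)
    then have "(y \<bullet> T y) / (norm y)\<^sup>2 \<le> \<mu>"
      by (simp add: T.scaleR power2_eq_square divide_inverse mult_ac)
    then show ?thesis
      using False by (simp add: divide_le_eq power2_norm_eq_inner)
  qed (simp add: T.zero)
  define r where "r = T x - \<mu> *\<^sub>R x"
  have rS: "r \<in> S"
    unfolding r_def using x inv S by (intro subspace_diff subspace_scale) auto
  have xx: "x \<bullet> x = 1"
    using x by (simp add: norm_eq_1)
  have xr: "x \<bullet> r = 0"
    by (simp add: r_def inner_diff_right \<mu>_def xx)
  have Tx: "T x = r + \<mu> *\<^sub>R x" by (simp add: r_def)
  have rTx: "r \<bullet> T x = r \<bullet> r"
    using xr by (simp add: Tx inner_add_right inner_commute)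
  define c where "c = \<mu> * (r \<bullet> r) - r \<bullet> T r"
  \<comment> \<open>Moving from \<open>x\<close> to \<open>x + s r\<close> gains
    \<open>2 s (r \<bullet> r)\<close> to first order, against a loss quadratic in \<open>s\<close>.
    Below, \<open>s = (r \<bullet> r) / c\<close> makes the gain win unless
    \<open>r = 0\<close>.\<close>
  have key: "2 * (r \<bullet> r) \<le> s * c" if "s > 0" for s
  proof -
    have "(x + s *\<^sub>R r) \<bullet> T (x + s *\<^sub>R r) \<le> \<mu> * ((x + s *\<^sub>R r) \<bullet> (x + s *\<^sub>R r))"
      using x rS S by (intro quad subspace_add subspace_scale)
    moreover have "(x + s *\<^sub>R r) \<bullet> T (x + s *\<^sub>R r) = \<mu> + 2 * s * (r \<bullet> r) + s\<^sup>2 * (r \<bullet> T r)"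
    proof -
      have "x \<bullet> T r = r \<bullet> r" using sym[of x r] rTx by (simp add: inner_commute)
      then show ?thesis
        by (simp add: T.add T.scaleR inner_add_left inner_add_right rTx \<mu>_def[symmetric]
            power2_eq_square algebra_simps)
    qed
    moreover have "(x + s *\<^sub>R r) \<bullet> (x + s *\<^sub>R r) = 1 + s\<^sup>2 * (r \<bullet> r)"
      using xr by (simp add: inner_add_left inner_add_right xx inner_commute power2_eq_square)
    ultimately have "\<mu> + 2 * s * (r \<bullet> r) + s\<^sup>2 * (r \<bullet> T r) \<le> \<mu> * (1 + s\<^sup>2 * (r \<bullet> r))"
      by (simp only:)
    then have "s * (2 * (r \<bullet> r)) \<le> s * (s * c)"
      by (simp add: c_def power2_eq_square algebra_simps)
    then show ?thesis using that by simp
  qed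
  have "r \<bullet> r \<le> 0"
  proof (cases "c > 0")
    case True
    show ?thesis
    proof (rule ccontr)
      assume "\<not> r \<bullet> r \<le> 0"
      then have "r \<bullet> r > 0" by linarith
      moreover from this True have "2 * (r \<bullet> r) \<le> r \<bullet> r"
        using key[of "(r \<bullet> r) / c"] by simp
      ultimately show False by simp
    qed
  next
    case False
    with key[of 1] show ?thesis by simp
  qed
  then have "r = 0" by (metis inner_gt_zero_iff not_less)
  then show ?thesis
    using that[of x \<mu>] x Tx by simp
qed

section \<open>The complex inner product and joint eigenvectors\<close>

definition cdot :: "complex^'n \<Rightarrow> complex^'n \<Rightarrow> complex" where
  "cdot x y = (\<Sum>i\<in>UNIV. cnj (x $ i) * y $ i)"

lemma inner_eq_Re_cdot: "x \<bullet> y = Re (cdot x y)"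
  by (simp add: cdot_def inner_vec_def inner_complex_def)

lemma cdot_matrix: "cdot x (A *v y) = cdot (ctranspose A *v x) y"
proof -
  have "cdot x (A *v y) = (\<Sum>i\<in>UNIV. \<Sum>j\<in>UNIV. cnj (x $ i) * A $ i $ j * y $ j)"
    by (simp add: cdot_def matrix_vector_mult_def sum_distrib_left mult.assoc)
  also have "\<dots> = cdot (ctranspose A *v x) y"
    by (subst sum.swap)
      (simp add: cdot_def matrix_vector_mult_def sum_distrib_left sum_distrib_right mult_ac cnj_sum)
  finally show ?thesis .
qed

lemma inner_matrix_vector: "x \<bullet> (A *v y) = (ctranspose A *v x) \<bullet> (y :: complex^'n)"
  by (simp add: inner_eq_Re_cdot cdot_matrix)

lemma cdot_scale_left: "cdot (c *s x) y = cnj c * cdot x y"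
  by (simp add: cdot_def sum_distrib_left mult.assoc)

lemma cdot_scale_right: "cdot x (c *s y) = c * cdot x y"
  by (simp add: cdot_def sum_distrib_left mult_ac)

lemma cdot_add_right: "cdot x (y + z) = cdot x y + cdot x z"
  by (simp add: cdot_def algebra_simps sum.distrib)

lemma cdot_scaleR_right: "cdot x (r *\<^sub>R y) = of_real r * cdot x y"
  by (simp add: cdot_def scaleR_sum_right flip: scaleR_conv_of_real)

lemma cdot_commute: "cdot y x = cnj (cdot x y)"
  by (simp add: cdot_def cnj_sum mult.commute)

lemma cdot_self: "cdot x x = of_real ((norm x)\<^sup>2)"
proof -
  have "(norm x)\<^sup>2 = (\<Sum>i\<in>UNIV. (norm (x $ i))\<^sup>2)"
    by (simp add: norm_vec_def L2_set_def sum_nonneg)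
  then show ?thesis
    by (simp add: cdot_def complex_norm_square mult.commute del: of_real_power)
qed

lemma cscale_vector: "cscale c A *v x = c *s (A *v x)"
  by (simp add: vec_eq_iff cscale_def matrix_vector_mult_def sum_distrib_left mult.assoc)

lemma scaleR_vector: "(r *\<^sub>R A) *v x = r *\<^sub>R (A *v (x :: complex^'n))"
  by (simp add: vec_eq_iff matrix_vector_mult_def scaleR_sum_right)

lemma mult_vector_scaleR: "A *v (r *\<^sub>R x) = r *\<^sub>R (A *v (x :: complex^'n))"
  by (simp add: vec_eq_iff matrix_vector_mult_def scaleR_sum_right)

lemma cscale_mult_left: "cscale c A ** B = cscale c (A ** B)"
  by (simp add: vec_eq_iff cscale_def matrix_mult_nth sum_distrib_left mult.assoc)

lemma cscale_mult_right: "A ** cscale c B = cscale c (A ** B)"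
  by (simp add: vec_eq_iff cscale_def matrix_mult_nth sum_distrib_left mult_ac)

lemma cscale_linear:
  "cscale c (A + B) = cscale c A + cscale c B" "cscale c (A - B) = cscale c A - cscale c B"
  "cscale c (r *\<^sub>R A) = r *\<^sub>R cscale c A"
  by (simp_all add: vec_eq_iff cscale_def algebra_simps)

text \<open>Write \<open>A = H + i K\<close> with \<open>H\<close> and \<open>K\<close> Hermitian;
  normality says that they commute, so an eigenspace of \<open>H\<close> is invariant under
  \<open>K\<close> and contains an eigenvector of both. Since \<open>subspace\<close> is meant over
  the reals, closure of \<open>S\<close> under multiplication by \<open>\<i>\<close> is a separate
  assumption; invariance under \<open>K\<close> relies on it.\<close>

lemma normal_eigenvector:
  fixes A :: "complex^'n^'n"
  assumes normal: "A ** ctranspose A = ctranspose A ** A"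
    and S: "subspace S" and Si: "\<And>x. x \<in> S \<Longrightarrow> \<i> *s x \<in> S"
    and inv: "\<And>x. x \<in> S \<Longrightarrow> A *v x \<in> S" "\<And>x. x \<in> S \<Longrightarrow> ctranspose A *v x \<in> S"
    and nz: "z \<in> S" "z \<noteq> 0"
  obtains x c where "x \<in> S" "norm x = 1" "A *v x = c *s x" "ctranspose A *v x = cnj c *s x"
proof -
  define H where "H = (1/2) *\<^sub>R (A + ctranspose A)"
  define K where "K = cscale (- \<i>) ((1/2) *\<^sub>R (A - ctranspose A))"
  have Hx: "H *v x = (1/2) *\<^sub>R (A *v x + ctranspose A *v x)" for x
    by (simp add: H_def scaleR_vector matrix_vector_mult_add_rdistrib)
  have Kx: "K *v x = - (\<i> *s ((1/2) *\<^sub>R (A *v x - ctranspose A *v x)))" for x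
    by (simp add: K_def scaleR_vector cscale_vector matrix_vector_mult_diff_rdistrib vec_eq_iff)
  have Hh: "ctranspose H = H" and Kh: "ctranspose K = K"
    by (simp_all add: H_def K_def vec_eq_iff cscale_def algebra_simps)
  have comm: "H ** K = K ** H"
    by (simp add: H_def K_def cscale_mult_left cscale_mult_right matrix_mult_scaleR_left
        matrix_mult_scaleR_right matrix_add_ldistrib matrix_add_rdistrib matrix_diff_ldistrib
        matrix_diff_rdistrib normal cscale_linear algebra_simps)
  have lin: "linear ((*v) M)" for M :: "complex^'n^'n"
    by simp
  have sc: "r *\<^sub>R x = complex_of_real r *s x" for r and x :: "complex^'n"
    by (simp add: vec_eq_iff) (simp add: scaleR_conv_of_real)
  obtain x1 \<mu> where x1: "x1 \<in> S" "norm x1 = 1" "H *v x1 = \<mu> *\<^sub>R x1"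
  proof (rule selfadjoint_eigenvector[OF lin[of H] S _ _ nz])
    show "H *v x \<in> S" if "x \<in> S" for x
      unfolding Hx using that inv S by (intro subspace_scale subspace_add) auto
    show "x \<bullet> (H *v y) = (H *v x) \<bullet> y" for x y
      by (simp add: inner_matrix_vector Hh)
  qed
  define S' where "S' = {x \<in> S. H *v x = \<mu> *\<^sub>R x}"
  have S': "subspace S'"
    using S unfolding S'_def subspace_def
    by (auto simp: matrix_vector_right_distrib scaleR_add_right mult_vector_scaleR)
  have nz1: "x1 \<in> S'" "x1 \<noteq> 0" using x1 by (auto simp: S'_def)
  obtain x \<nu> where x: "x \<in> S'" "norm x = 1" "K *v x = \<nu> *\<^sub>R x"
  proof (rule selfadjoint_eigenvector[OF lin[of K] S' _ _ nz1])
    show "K *v x \<in> S'" if "x \<in> S'" for x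
    proof -
      have "K *v x \<in> S"
        unfolding Kx using that inv S
        by (intro subspace_neg Si subspace_scale subspace_diff) (auto simp: S'_def)
      moreover have "H *v (K *v x) = \<mu> *\<^sub>R (K *v x)"
        using that by (simp add: S'_def matrix_vector_mul_assoc comm)
          (simp flip: matrix_vector_mul_assoc add: mult_vector_scaleR)
      ultimately show ?thesis by (simp add: S'_def)
    qed
    show "x \<bullet> (K *v y) = (K *v x) \<bullet> y" for x y
      by (simp add: inner_matrix_vector Kh)
  qed
  have HKx: "H *v x = of_real \<mu> *s x" "K *v x = of_real \<nu> *s x"
    using x by (auto simp: S'_def sc)
  have "A = H + cscale \<i> K" "ctranspose A = H - cscale \<i> K"
    by (auto simp: H_def K_def vec_eq_iff cscale_def algebra_simps)
  then have "A *v x = H *v x + \<i> *s (K *v x)" "ctranspose A *v x = H *v x - \<i> *s (K *v x)"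
    by (metis matrix_vector_mult_add_rdistrib cscale_vector)
      (metis \<open>ctranspose A = H - cscale \<i> K\<close> matrix_vector_mult_diff_rdistrib cscale_vector)
  then have "A *v x = Complex \<mu> \<nu> *s x" "ctranspose A *v x = cnj (Complex \<mu> \<nu>) *s x"
    unfolding HKx by (auto simp: vec_eq_iff Complex_eq algebra_simps)
  then show ?thesis
    using that x by (auto simp: S'_def)
qed

lemma singular_zero_row:
  fixes M :: "complex^'n^'n"
  assumes "M $ i = 0"
  obtains x where "x \<noteq> 0" "M *v x = 0"
proof -
  have "\<not> invertible M"
    using det_zero_row(1)[of i M] assms by (simp add: invertible_det_nz row_def vec_eq_iff)
  then show ?thesis
    using that by (auto simp: invertible_left_inverse matrix_left_invertible_ker)
qed

text \<open>Induction over subsets of the index type itself yields a basis already indexed by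
  \<open>'n\<close>. The eigenvalue equation for the adjoint is carried along because it makes the
  orthogonal complement of the vectors found so far invariant under \<open>A\<close>, as the one for
  \<open>A\<close> does for the adjoint.\<close>

lemma normal_orthonormal_eigenvectors:
  fixes A :: "complex^'n^'n" and I :: "'n set"
  assumes normal: "A ** ctranspose A = ctranspose A ** A"
  shows "\<exists>v c. (\<forall>i\<in>I. \<forall>j\<in>I. cdot (v i) (v j) = (if i = j then 1 else 0)) \<and>
    (\<forall>i\<in>I. A *v v i = c i *s v i \<and> ctranspose A *v v i = cnj (c i) *s v i)"
  using finite[of I]
proof (induction I rule: finite_induct)
  case (insert i I)
  then obtain v :: "'n \<Rightarrow> complex^'n" and c where
    orth: "\<And>j k. j \<in> I \<Longrightarrow> k \<in> I \<Longrightarrow> cdot (v j) (v k) = (if j = k then 1 else 0)" and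
    eig: "\<And>j. j \<in> I \<Longrightarrow> A *v v j = c j *s v j" "\<And>j. j \<in> I \<Longrightarrow> ctranspose A *v v j = cnj (c j) *s v j"
    by blast
  define S where "S = {x. \<forall>j\<in>I. cdot (v j) x = 0}"
  define M :: "complex^'n^'n" where "M = (\<chi> j k. if j \<in> I then cnj (v j $ k) else 0)"
  have "M $ i = 0"
    using insert by (simp add: M_def vec_eq_iff)
  then obtain z where z: "z \<noteq> 0" "M *v z = 0"
    by (rule singular_zero_row)
  have "z \<in> S"
  proof -
    have "cdot (v j) z = (M *v z) $ j" if "j \<in> I" for j
      using that by (simp add: M_def cdot_def matrix_vector_mult_def)
    then show ?thesis by (simp add: S_def z)
  qed
  have S: "subspace S"
    by (auto simp: S_def subspace_def cdot_add_right cdot_scaleR_right) (simp add: cdot_def)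
  obtain x d where x: "x \<in> S" "norm x = 1" "A *v x = d *s x" "ctranspose A *v x = cnj d *s x"
  proof (rule normal_eigenvector[OF normal S _ _ _ \<open>z \<in> S\<close> \<open>z \<noteq> 0\<close>])
    show "\<i> *s x \<in> S" if "x \<in> S" for x
      using that by (simp add: S_def cdot_scale_right)
    show "A *v x \<in> S" if "x \<in> S" for x
      using that eig by (simp add: S_def cdot_matrix cdot_scale_left)
    show "ctranspose A *v x \<in> S" if "x \<in> S" for x
      using that eig by (simp add: S_def cdot_matrix cdot_scale_left)
  qed
  have "cdot (v j) x = 0" if "j \<in> I" for j
    using x(1) that by (simp add: S_def)
  moreover have "cdot x (v j) = 0" if "j \<in> I" for j
    using x(1) that by (subst cdot_commute) (simp add: S_def)
  moreover have "cdot x x = 1" using x(2) by (simp add: cdot_self)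
  ultimately show ?case
    using orth eig x insert(2)
    by (intro exI[of _ "v(i := x)"] exI[of _ "c(i := d)"]) auto
qed simp

theorem normal_diagonalization:
  fixes A :: "complex^'n^'n"
  assumes normal: "A ** ctranspose A = ctranspose A ** A"
  obtains Q d where "unitary Q" "A = Q ** dg d ** ctranspose Q"
proof -
  obtain v :: "'n \<Rightarrow> complex^'n" and c where
    orth: "\<And>j k. cdot (v j) (v k) = (if j = k then 1 else 0)" and
    eig: "\<And>j. A *v v j = c j *s v j"
    using normal_orthonormal_eigenvectors[OF normal, of UNIV] by blast
  define Q where "Q = (\<chi> i j. v j $ i)"
  have "ctranspose Q ** Q = mat 1"
    using orth by (simp add: vec_eq_iff matrix_mult_nth Q_def cdot_def mat_def)
  then have Q: "unitary Q"
    by (simp add: unitary_def matrix_left_right_inverse)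
  have "A ** Q = Q ** dg (\<chi> j. c j)"
  proof -
    have "(A ** Q) $ i $ j = (A *v v j) $ i" for i j
      by (simp add: matrix_mult_nth matrix_vector_mult_def Q_def)
    then show ?thesis
      by (simp add: vec_eq_iff eig Q_def mult.commute)
  qed
  then have "A = Q ** dg (\<chi> j. c j) ** ctranspose Q"
    by (metis Q unitary_cancel(3))
  then show ?thesis using that Q by blast
qed

lemma diagonalization_entry:
  assumes "unitary Q" "A = Q ** dg d ** ctranspose Q"
  shows "dg d = ctranspose Q ** A ** Q"
  by (simp add: assms(2) unitary_cancel(1)[OF assms(1)] unitary_cancel(4)[OF assms(1)]
      flip: matrix_mul_assoc) (simp add: assms(1)[unfolded unitary_def] matrix_mul_assoc)

lemma hermitian_diagonalization:
  assumes "hermitian A"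
  obtains Q d where "unitary Q" "\<And>i. d $ i \<in> \<real>" "A = Q ** dg d ** ctranspose Q"
proof -
  obtain Q d where Q: "unitary Q" and A: "A = Q ** dg d ** ctranspose Q"
    using normal_diagonalization[of A] assms by (metis hermitian_def)
  have "ctranspose (dg d) = dg d"
    using assms unfolding diagonalization_entry[OF Q A]
    by (simp add: ctranspose_mult hermitian_def matrix_mul_assoc)
  then have "ctranspose (dg d) $ i $ i = dg d $ i $ i" for i
    by simp
  then have "cnj (d $ i) = d $ i" for i
    by simp
  then have "d $ i \<in> \<real>" for i
    by (simp add: Reals_cnj_iff)
  then show ?thesis using that Q A by blast
qed

lemma unitary_diagonalization:
  assumes "unitary A"
  obtains Q d where "unitary Q" "\<And>i. norm (d $ i) = 1" "A = Q ** dg d ** ctranspose Q"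
proof -
  obtain Q d where Q: "unitary Q" and A: "A = Q ** dg d ** ctranspose Q"
    using normal_diagonalization[of A] assms by (metis unitary_def)
  have "unitary (dg d)"
    unfolding diagonalization_entry[OF Q A] using Q assms
    by (intro unitary_mult unitary_ctranspose)
  then have "(dg d ** ctranspose (dg d)) $ i $ i = 1" for i
    by (simp add: unitary_def mat_def)
  then have "of_real ((norm (d $ i))\<^sup>2) = (1 :: complex)" for i
    by (simp add: complex_norm_square del: of_real_power)
  then have "(norm (d $ i))\<^sup>2 = 1" for i
    by (metis of_real_eq_1_iff)
  then have "norm (d $ i) = 1" for i
    by (simp add: power2_eq_1_iff) (smt (verit) norm_ge_zero)
  then show ?thesis using that Q A by blast
qed

section \<open>Symmetric Lagrangians\<close>

definition diag :: "complex^'n^'n \<Rightarrow> complex^'n" where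
  "diag A = (\<chi> i. A $ i $ i)"

lemma diag_nth [simp]: "diag A $ i = A $ i $ i"
  by (simp add: diag_def)

lemma diag_scaleR: "diag (r *\<^sub>R A) = r *\<^sub>R diag A"
  by (simp add: vec_eq_iff)

context
  fixes L :: "complex^'n^'n \<Rightarrow> real"
  assumes L: "symmetric_lagrangian L"
begin

lemma lagrangian_convex:
  assumes "0 \<le> u" "0 \<le> v" "u + v = 1"
  shows "L (u *\<^sub>R A + v *\<^sub>R B) \<le> u * L A + v * L B"
  using L assms by (auto simp: symmetric_lagrangian_def convex_on_def)

lemma lagrangian_unitary: "unitary U \<Longrightarrow> unitary V \<Longrightarrow> L (U ** A ** V) = L A"
  using L by (auto simp: symmetric_lagrangian_def)

lemma lagrangian_unitary_left: "unitary U \<Longrightarrow> L (U ** A) = L A"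
  using lagrangian_unitary[of U "mat 1" A] by (simp add: unitary_mat1)

lemma lagrangian_conj: "unitary Q \<Longrightarrow> L (Q ** A ** ctranspose Q) = L A"
  by (simp add: lagrangian_unitary unitary_ctranspose)

lemma lagrangian_continuous: "continuous_on UNIV L"
  using L by (intro convex_on_continuous) (auto simp: symmetric_lagrangian_def)

text \<open>Subadditivity of the perspective \<open>t * L (A / t)\<close>. This is Jensen's
  inequality in a form that can be accumulated step by step, with \<open>t\<close> the elapsed time.
  At \<open>t = 0\<close> the first summand on the right is 0, and \<open>A = 0\<close> makes the
  claim an equality.\<close>

lemma lagrangian_perspective:
  assumes "0 \<le> t" "0 < e" "t = 0 \<longrightarrow> A = 0"
  shows "(t + e) * L ((A + B) /\<^sub>R (t + e)) \<le> t * L (A /\<^sub>R t) + e * L (B /\<^sub>R e)"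
proof -
  have te: "t + e > 0" using assms by simp
  have "(A + B) /\<^sub>R (t + e) = (t / (t + e)) *\<^sub>R (A /\<^sub>R t) + (e / (t + e)) *\<^sub>R (B /\<^sub>R e)"
  proof -
    have "t / (t + e) * inverse t = inverse (t + e)" if "t \<noteq> 0"
      using that te by (simp add: field_simps)
    then have "(t / (t + e)) *\<^sub>R (A /\<^sub>R t) = A /\<^sub>R (t + e)"
      using assms(3) by (cases "t = 0") simp_all
    moreover have "e / (t + e) * inverse e = inverse (t + e)"
      using te assms(2) by (simp add: field_simps)
    then have "(e / (t + e)) *\<^sub>R (B /\<^sub>R e) = B /\<^sub>R (t + e)"
      by simp
    ultimately show ?thesis by (simp only: scaleR_add_right)
  qed
  also have "L \<dots> \<le> (t / (t + e)) * L (A /\<^sub>R t) + (e / (t + e)) * L (B /\<^sub>R e)"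
    using assms te by (intro lagrangian_convex) (auto simp flip: add_divide_distrib)
  also have "\<dots> = (t * L (A /\<^sub>R t) + e * L (B /\<^sub>R e)) / (t + e)"
    by (simp add: add_divide_distrib)
  finally show ?thesis
    unfolding pos_le_divide_eq[OF te] by (simp only: mult.commute)
qed

text \<open>Conjugating by the reflection in coordinate \<open>i\<close> and averaging annihilates the off-diagonal
  part of row and column \<open>i\<close>.\<close>

lemma lagrangian_pinching_partial:
  "L (\<chi> j k. if j \<noteq> k \<and> (j \<in> I \<or> k \<in> I) then 0 else A $ j $ k) \<le> L A"
  using finite[of I]
proof (induction I rule: finite_induct)
  case (insert i I)
  define B where "B = (\<chi> j k. if j \<noteq> k \<and> (j \<in> I \<or> k \<in> I) then 0 else A $ j $ k)"
  define S where "S = dg (\<chi> j. if j = i then - 1 else 1)"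
  have S: "unitary S" unfolding S_def by (rule unitary_dg) auto
  have "(\<chi> j k. if j \<noteq> k \<and> (j \<in> insert i I \<or> k \<in> insert i I) then 0 else A $ j $ k)
    = (1/2) *\<^sub>R B + (1/2) *\<^sub>R (S ** B ** S)"
    by (auto simp: vec_eq_iff S_def B_def)
  also have "L \<dots> \<le> 1/2 * L B + 1/2 * L (S ** B ** S)"
    by (intro lagrangian_convex) auto
  also have "\<dots> = L B" by (simp add: lagrangian_unitary S)
  also have "\<dots> \<le> L A" using insert.IH by (simp add: B_def)
  finally show ?case .
qed simp

lemma lagrangian_pinching: "L (dg (diag A)) \<le> L A"
proof -
  have "dg (diag A) = (\<chi> j k. if j \<noteq> k \<and> (j \<in> UNIV \<or> k \<in> UNIV) then 0 else A $ j $ k)"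
    by (auto simp: vec_eq_iff)
  then show ?thesis using lagrangian_pinching_partial[of UNIV A] by simp
qed

text \<open>A number of modulus \<open>r\<close> at most 1 is the mean of \<open>w\<close> and
  \<open>- w\<close> with weights \<open>(1 + r) / 2\<close> and \<open>(1 - r) / 2\<close> for a
  unimodular \<open>w\<close>, and multiplying one coordinate by a unimodular number is a unitary
  operation.\<close>

lemma lagrangian_dg_contract:
  assumes "norm c \<le> 1"
  shows "L (dg (\<chi> j. if j = i then c * y $ j else y $ j)) \<le> L (dg y)"
proof -
  define r where "r = norm c"
  define P where "P w = dg (\<chi> j. if j = i then w else 1)" for w :: complex
  have P: "unitary (P w)" if "norm w = 1" for w
    unfolding P_def using that by (intro unitary_dg) auto
  define w where "w = (if c = 0 then 1 else sgn c)"
  have w: "norm w = 1" and c: "c = of_real r * w"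
    by (auto simp: w_def r_def norm_sgn) (simp add: sgn_div_norm scaleR_conv_of_real)
  have "dg (\<chi> j. if j = i then c * y $ j else y $ j)
    = ((1 + r) / 2) *\<^sub>R (P w ** dg y) + ((1 - r) / 2) *\<^sub>R (P (- w) ** dg y)"
    by (auto simp: vec_eq_iff P_def c) (simp_all add: scaleR_conv_of_real field_simps)
  also have "L \<dots> \<le> ((1 + r) / 2) * L (P w ** dg y) + ((1 - r) / 2) * L (P (- w) ** dg y)"
    using assms by (intro lagrangian_convex) (auto simp: r_def field_simps)
  also have "\<dots> = L (dg y)"
    using w by (simp add: lagrangian_unitary_left P field_simps)
  finally show ?thesis .
qed

lemma lagrangian_dg_mono:
  assumes "\<And>i. norm (x $ i) \<le> norm (y $ i)"
  shows "L (dg x) \<le> L (dg y)"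
proof -
  define c where "c i = (if y $ i = 0 then 0 else x $ i / y $ i)" for i
  have c: "norm (c i) \<le> 1" "x $ i = c i * y $ i" for i
    using assms[of i] by (auto simp: c_def norm_divide divide_le_eq_1)
  have "L (dg (\<chi> j. if j \<in> I then x $ j else y $ j)) \<le> L (dg y)" for I :: "'n set"
    using finite[of I]
  proof (induction I rule: finite_induct)
    case (insert i I)
    let ?z = "\<chi> j. if j \<in> I then x $ j else y $ j"
    have "(\<chi> j. if j \<in> insert i I then x $ j else y $ j) = (\<chi> j. if j = i then c i * ?z $ j else ?z $ j)"
      using insert(2) c(2) by (auto simp: vec_eq_iff)
    then show ?case
      using lagrangian_dg_contract[OF c(1)[of i], of i ?z] insert.IH by simp
  qed simp
  from this[of UNIV] show ?thesis by simp
qed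

lemma lagrangian_dg_cong:
  assumes "\<And>i. norm (x $ i) = norm (y $ i)"
  shows "L (dg x) = L (dg y)"
  using assms by (intro antisym lagrangian_dg_mono) auto

end

section \<open>A semiconvex angle function on the circle\<close>

lemma abs_diff_sin_le: "\<bar>x - sin x\<bar> \<le> x\<^sup>2" for x :: real
proof -
  have "\<bar>sin x - x\<bar> \<le> x\<^sup>2 / 2"
    using Maclaurin_sin_bound[of x 2] by (simp add: numeral_2_eq_2 sin_coeff_def)
  then show ?thesis using zero_le_power2[of x] by linarith
qed

text \<open>Here \<open>1 - cos x = 2 (sin (x/2))^2\<close>, and the crude bound
  \<open>sin y >= y / 3\<close> on \<open>[0,2]\<close> gives the constant
  \<open>18 = 2 * 9\<close>. It turns a quadratic error in an angle into \<open>1 - Re\<close> of a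
  ratio of eigenvalues, which is affine in each eigenvalue and can therefore be averaged.\<close>

lemma square_le_one_minus_cos:
  assumes "\<bar>x\<bar> \<le> pi"
  shows "x\<^sup>2 \<le> 18 * (1 - cos x)"
proof -
  define y where "y = \<bar>x\<bar> / 2"
  have y: "0 \<le> y" "y \<le> 2"
    using assms pi_less_4 by (auto simp: y_def)
  have "\<bar>sin y - y\<bar> \<le> y ^ 3 / 6"
    using Maclaurin_sin_bound[of y 3] y by (simp add: numeral_3_eq_3 sin_coeff_def fact_numeral field_simps)
  moreover have "y ^ 3 \<le> 4 * y"
    using mult_mono[of y 2 y 2] y mult_right_mono[of "y * y" 4 y]
    by (simp add: power3_eq_cube)
  ultimately have "y / 3 \<le> sin y" by linarith
  then have "(y / 3)\<^sup>2 \<le> (sin y)\<^sup>2"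
    using y by (intro power_mono) auto
  moreover have "cos x = 1 - 2 * (sin y)\<^sup>2"
    using cos_double_sin[of y] by (simp add: y_def abs_if split: if_splits)
  moreover have "x\<^sup>2 = 4 * y\<^sup>2"
    by (simp add: y_def power_divide)
  ultimately show ?thesis
    by (simp add: power_divide)
qed

text \<open>The derivative \<open>2 * max 0 (u - m)\<close> is Lipschitz with constant 2, so the
  function departs from its tangent by at most \<open>(w - u)^2\<close>.\<close>

lemma square_max_tangent:
  "(max 0 (w - m))\<^sup>2 \<le> (max 0 (u - m))\<^sup>2 + 2 * max 0 (u - m) * (w - u) + (w - u)\<^sup>2" for w u m :: real
proof (cases "w \<le> m")
  case True
  have "0 \<le> (max 0 (u - m) + (w - u))\<^sup>2" by simp
  also have "\<dots> = (max 0 (u - m))\<^sup>2 + 2 * max 0 (u - m) * (w - u) + (w - u)\<^sup>2"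
    by (simp add: power2_sum)
  finally show ?thesis using True by simp
next
  case False
  then have "max 0 (w - m) \<le> max 0 (u - m) + (w - u)" if "u \<ge> m"
    using that by simp
  moreover have "0 \<le> max 0 (w - m)" by simp
  moreover have "(w - m)\<^sup>2 \<le> (w - u)\<^sup>2" if "u < m"
    using that False by (intro power_mono) auto
  ultimately show ?thesis using False
    by (cases "u < m") (auto simp: power2_eq_square algebra_simps)
qed

text \<open>The function \<open>|Arg \<mu>|\<close> has a concave kink at \<open>-1\<close>, where it violates the inequality
  below; it is therefore flattened quadratically on angles between \<open>m\<close> and \<open>\<pi>\<close>.\<close>

lemma semiconvex_angle_function:
  assumes m: "0 \<le> m" "m < pi"
  obtains g :: "complex \<Rightarrow> real" and C where
    "0 \<le> C" "\<And>\<mu>. 0 \<le> g \<mu>" "\<And>s. \<bar>s\<bar> \<le> m \<Longrightarrow> g (cis s) = \<bar>s\<bar>"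
    "\<And>\<kappa>. norm \<kappa> = 1 \<Longrightarrow> \<exists>p. \<bar>p\<bar> \<le> 1 \<and> (\<forall>\<mu>. norm \<mu> = 1 \<longrightarrow>
       g \<kappa> \<le> g \<mu> + p * Im (\<kappa> * cnj \<mu>) + C * (1 - Re (\<kappa> * cnj \<mu>)))"
proof -
  define q where "q = pi - m"
  have q: "q > 0" using m by (simp add: q_def)
  \<comment> \<open>The slope of \<open>h\<close> is 1 up to \<open>m\<close> and then falls
    linearly to 0 at \<open>pi\<close>, which determines the denominator \<open>2 * q\<close>. The
    slopes of \<open>h \<bar>s\<bar>\<close> on the two sides of the branch cut thus agree. The kink
    at angle 0 is convex and does no harm.\<close>
  define h where "h s = s - (max 0 (s - m))\<^sup>2 / (2 * q)" for s
  define h' where "h' s = 1 - max 0 (s - m) / q" for s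
  \<comment> \<open>The summand \<open>1 / (2 * q)\<close> bounds the deviation of \<open>h\<close>
    from its tangent, the summand 1 pays for replacing an angle difference by its sine, and 18 comes
    from \<open>square_le_one_minus_cos\<close>.\<close>
  define C where "C = 18 * (1 / (2 * q) + 1)"
  have C: "C \<ge> 0" using q by (simp add: C_def)
  have h'_bounds: "0 \<le> h' u" "h' u \<le> 1" if "u \<le> pi" for u
    using q that by (auto simp: h'_def q_def field_simps)
  have h_nonneg: "0 \<le> h s" if "0 \<le> s" "s \<le> pi" for s
  proof (cases "s \<le> m")
    case True
    then show ?thesis using that by (simp add: h_def)
  next
    case False
    have "(s - m)\<^sup>2 \<le> q * (s - m)"
      using False that by (simp add: power2_eq_square q_def)
    then have "(s - m)\<^sup>2 / (2 * q) \<le> (s - m) / 2"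
      using q by (simp add: field_simps)
    also have "(s - m) / 2 \<le> s" using m that by simp
    finally have "(s - m)\<^sup>2 / (2 * q) \<le> s" .
    then show ?thesis using False by (simp add: h_def)
  qed
  have tangent: "h u \<le> h w + h' u * (u - w) + (u - w)\<^sup>2 / (2 * q)" for u w
    using divide_right_mono[OF square_max_tangent[of w m u], of "2 * q"] q
    by (simp add: h_def h'_def power2_commute[of w u] add_divide_distrib) (simp add: algebra_simps diff_divide_distrib)
  \<comment> \<open>Beyond \<open>m\<close> the graph of \<open>h\<close> is a parabola with vertex
    at \<open>pi\<close>, hence symmetric about it, and to the left of \<open>m\<close> the line
    lies above that parabola. This serves the case of two angles more than \<open>pi\<close> apart,
    where one is replaced by its representative beyond the cut.\<close>
  have reflect: "h (2 * pi - v) \<le> h v" if "0 \<le> v" "v \<le> pi" for v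
  proof -
    define e where "e = pi - v"
    have e: "0 \<le> e" using that by (simp add: e_def)
    have v: "v = m + q - e" by (simp add: e_def q_def)
    have "h (2 * pi - v) = 2 * pi - v - (e + q)\<^sup>2 / (2 * q)"
      using e q by (simp add: h_def e_def q_def)
    also have "\<dots> = v - (q - e)\<^sup>2 / (2 * q)"
      using q by (simp add: e_def field_simps power2_eq_square)
    also have "\<dots> \<le> h v"
      using q by (auto simp: h_def v max_def intro!: divide_right_mono)
    finally show ?thesis .
  qed
  have trig: "h' u * d + d\<^sup>2 / (2 * q) \<le> h' u * sin d + C * (1 - cos d)"
    if "u \<le> pi" "\<bar>d\<bar> \<le> pi" for u d
  proof -
    have "h' u * (d - sin d) \<le> 1 * d\<^sup>2"
      using h'_bounds[OF that(1)] abs_diff_sin_le[of d]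
      by (smt (verit) mult_left_le_one_le mult_left_mono mult_right_mono zero_le_power2)
    then have "h' u * d + d\<^sup>2 / (2 * q) \<le> h' u * sin d + (1 / (2 * q) + 1) * d\<^sup>2"
      by (simp add: algebra_simps)
    also have "(1 / (2 * q) + 1) * d\<^sup>2 \<le> (1 / (2 * q) + 1) * (18 * (1 - cos d))"
      using q by (intro mult_left_mono square_le_one_minus_cos that) auto
    finally show ?thesis unfolding C_def by (simp only: mult_ac)
  qed
  have main: "h u \<le> h \<bar>w\<bar> + h' u * sin (u - w) + C * (1 - cos (u - w))"
    if u: "0 \<le> u" "u \<le> pi" and w: "\<bar>w\<bar> \<le> pi" for u w
  proof (cases "u - w \<le> pi")
    case True
    have "h w \<le> h \<bar>w\<bar>"
    proof (cases "w \<ge> 0")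
      case False
      then have "h w \<le> 0" using m by (simp add: h_def)
      also have "0 \<le> h \<bar>w\<bar>" using w by (intro h_nonneg) auto
      finally show ?thesis .
    qed simp
    then show ?thesis
      using tangent[of u w] trig[of u "u - w"] u w True by linarith
  next
    case False
    have "h (w + 2 * pi) \<le> h \<bar>w\<bar>"
      using reflect[of "\<bar>w\<bar>"] False u w by (simp add: add.commute)
    moreover have "sin (u - (w + 2 * pi)) = sin (u - w)" "cos (u - (w + 2 * pi)) = cos (u - w)"
      using sin_periodic[of "u - w - 2 * pi"] cos_periodic[of "u - w - 2 * pi"]
      by (simp_all add: algebra_simps)
    ultimately show ?thesis
      using tangent[of u "w + 2 * pi"] trig[of u "u - (w + 2 * pi)"] u w False by simp
  qed
  define g where "g \<mu> = h \<bar>Arg \<mu>\<bar>" for \<mu>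
  show ?thesis
  proof (rule that[of C g])
    show "0 \<le> g \<mu>" for \<mu>
      unfolding g_def using mpi_less_Arg[of \<mu>] Arg_le_pi[of \<mu>] by (intro h_nonneg) auto
    show "g (cis s) = \<bar>s\<bar>" if "\<bar>s\<bar> \<le> m" for s
    proof -
      have "Arg (cis s) = s" using that m by (intro Arg_cis) auto
      then show ?thesis using that by (simp add: g_def h_def)
    qed
    show "\<exists>p. \<bar>p\<bar> \<le> 1 \<and> (\<forall>\<mu>. norm \<mu> = 1 \<longrightarrow>
       g \<kappa> \<le> g \<mu> + p * Im (\<kappa> * cnj \<mu>) + C * (1 - Re (\<kappa> * cnj \<mu>)))" if "norm \<kappa> = 1" for \<kappa>
    proof -
      \<comment> \<open>Conjugation changes the sign of both angles and of the sine of their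
        difference but leaves the cosine, so \<open>\<kappa>\<close> may be taken in the closed
        upper half circle at the price of a sign in \<open>p\<close>.\<close>
      define \<sigma> :: real where "\<sigma> = (if Arg \<kappa> \<ge> 0 then 1 else - 1)"
      have sigma: "\<sigma> = 1 \<or> \<sigma> = - 1" by (simp add: \<sigma>_def)
      have abs_arg: "\<bar>Arg \<nu>\<bar> \<le> pi" for \<nu>
        using mpi_less_Arg[of \<nu>] Arg_le_pi[of \<nu>] by auto
      show ?thesis
      proof (intro exI[of _ "\<sigma> * h' \<bar>Arg \<kappa>\<bar>"] conjI allI impI)
        show "\<bar>\<sigma> * h' \<bar>Arg \<kappa>\<bar>\<bar> \<le> 1"
          using sigma h'_bounds[OF abs_arg, of \<kappa>] by (auto simp: abs_mult)
        fix \<mu> :: complex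
        assume "norm \<mu> = 1"
        then have "\<mu> \<noteq> 0" "\<kappa> \<noteq> 0"
          using that by auto
        then have "\<mu> = cis (Arg \<mu>)" "\<kappa> = cis (Arg \<kappa>)"
          using that \<open>norm \<mu> = 1\<close> by (simp_all add: cis_Arg sgn_div_norm)
        then have prod: "\<kappa> * cnj \<mu> = cis (Arg \<kappa> - Arg \<mu>)"
          by (metis cis_cnj cis_mult uminus_add_conv_diff add.commute)
        have "\<bar>Arg \<kappa>\<bar> = \<sigma> * Arg \<kappa>" "\<bar>\<sigma> * Arg \<mu>\<bar> = \<bar>Arg \<mu>\<bar>"
          by (auto simp: \<sigma>_def)
        moreover have "sin (\<sigma> * (Arg \<kappa> - Arg \<mu>)) = \<sigma> * sin (Arg \<kappa> - Arg \<mu>)"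
          "cos (\<sigma> * (Arg \<kappa> - Arg \<mu>)) = cos (Arg \<kappa> - Arg \<mu>)"
          using sigma sin_minus[of "Arg \<kappa> - Arg \<mu>"] cos_minus[of "Arg \<kappa> - Arg \<mu>"]
          by (auto simp del: minus_diff_eq)
        moreover have "\<bar>Arg \<kappa>\<bar> - \<sigma> * Arg \<mu> = \<sigma> * (Arg \<kappa> - Arg \<mu>)"
          by (auto simp: \<sigma>_def)
        ultimately show "g \<kappa> \<le> g \<mu> + \<sigma> * h' \<bar>Arg \<kappa>\<bar> * Im (\<kappa> * cnj \<mu>) + C * (1 - Re (\<kappa> * cnj \<mu>))"
          using main[of "\<bar>Arg \<kappa>\<bar>" "\<sigma> * Arg \<mu>"] abs_arg[of \<kappa>] abs_arg[of \<mu>]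
          unfolding prod g_def by (simp add: mult_ac)
      qed
    qed
  qed (fact C)
qed

section \<open>Growth of the eigenvalue angles\<close>

definition angles :: "(complex \<Rightarrow> real) \<Rightarrow> complex^'n \<Rightarrow> complex^'n" where
  "angles g l = (\<chi> i. of_real (g (l $ i)))"

lemma angles_nth [simp]: "angles g l $ i = of_real (g (l $ i))"
  by (simp add: angles_def)

text \<open>The quantification over all diagonalizations avoids showing that \<open>L (dg (angles g l))\<close> is
  independent of the choice of eigenbasis. At \<open>t = 0\<close> the division by \<open>t\<close> is junk, hence the
  first conjunct.\<close>

definition angle_bound ::
    "(complex^'n^'n \<Rightarrow> real) \<Rightarrow> (complex \<Rightarrow> real) \<Rightarrow> real \<Rightarrow> complex^'n^'n \<Rightarrow> real \<Rightarrow> bool" where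
  "angle_bound L g t W s \<longleftrightarrow>
     (\<forall>Q l. unitary Q \<longrightarrow> (\<forall>i. norm (l $ i) = 1) \<longrightarrow> W = Q ** dg l ** ctranspose Q \<longrightarrow>
       (t = 0 \<longrightarrow> angles g l = 0) \<and> t * L (dg (angles g l) /\<^sub>R t) \<le> s)"

lemma norm_diag_le: "norm (diag A) \<le> norm A"
proof -
  have "(norm (A $ i $ i))\<^sup>2 \<le> (\<Sum>j\<in>UNIV. (norm (A $ i $ j))\<^sup>2)" for i
    by (rule member_le_sum) auto
  then have "(norm (diag A))\<^sup>2 \<le> (norm A)\<^sup>2"
    unfolding norm_matrix_sq norm_vec_def[of "diag A"] L2_set_def
    by (simp add: sum_nonneg sum_mono)
  then show ?thesis by (rule power2_le_imp_le) simp
qed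

lemma conj_dg_diag: "(R ** dg x ** ctranspose R) $ j $ j = (\<Sum>k\<in>UNIV. of_real ((norm (R $ j $ k))\<^sup>2) * x $ k)"
proof -
  have "(R ** dg x ** ctranspose R) $ j $ j = (\<Sum>k\<in>UNIV. R $ j $ k * x $ k * cnj (R $ j $ k))"
    by (subst matrix_mult_nth) simp
  also have "\<dots> = (\<Sum>k\<in>UNIV. of_real ((norm (R $ j $ k))\<^sup>2) * x $ k)"
    by (intro sum.cong refl) (simp add: complex_norm_square mult_ac del: of_real_power)
  finally show ?thesis .
qed

text \<open>First order perturbation theory without eigenvalue derivatives: the weights \<open>|R\<^sub>j\<^sub>k|\<^sup>2\<close> form a
  doubly stochastic matrix, and averaging \<open>1 - cnj l'\<^sub>j l\<^sub>k\<close> against them gives the diagonal of \<open>M\<close>.\<close>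

lemma eigenvalue_angle_step:
  fixes W W' :: "complex^'n^'n" and g :: "complex \<Rightarrow> real"
  assumes C: "0 \<le> C"
    and semi: "\<And>\<kappa>. norm \<kappa> = 1 \<Longrightarrow> \<exists>p. \<bar>p\<bar> \<le> 1 \<and> (\<forall>\<mu>. norm \<mu> = 1 \<longrightarrow>
       g \<kappa> \<le> g \<mu> + p * Im (\<kappa> * cnj \<mu>) + C * (1 - Re (\<kappa> * cnj \<mu>)))"
    and Q: "unitary Q" "\<And>i. norm (l $ i) = 1" "W = Q ** dg l ** ctranspose Q"
    and Q': "unitary Q'" "\<And>i. norm (l' $ i) = 1" "W' = Q' ** dg l' ** ctranspose Q'"
    and R: "R = ctranspose Q' ** Q"
    and M: "M = ctranspose Q' ** (ctranspose W' ** (W' - W)) ** Q'"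
  shows "g (l' $ j) \<le> Re ((R ** dg (angles g l) ** ctranspose R) $ j $ j) + norm (M $ j $ j)
    + C * (norm (W' - W))\<^sup>2 / 2"
proof -
  define P where "P k = (norm (R $ j $ k))\<^sup>2" for k
  have "unitary R"
    unfolding R by (intro unitary_mult unitary_ctranspose Q Q')
  then have Psum: "(\<Sum>k\<in>UNIV. P k) = 1"
    unfolding P_def by (rule unitary_row)
  have Pnn: "0 \<le> P k" for k by (simp add: P_def)
  have uW': "unitary W'"
    unfolding Q'(3) by (intro unitary_mult unitary_ctranspose unitary_dg Q')
  have W'W': "ctranspose W' ** W' = mat 1"
    using uW' by (simp add: unitary_def)
  have Q'Q': "ctranspose Q' ** Q' = mat 1"
    using Q' by (simp add: unitary_def)
  have M1: "M = mat 1 - dg (\<chi> i. cnj (l' $ i)) ** (R ** dg l ** ctranspose R)"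
  proof -
    have "M = ctranspose Q' ** Q' - ctranspose Q' ** (ctranspose W' ** W) ** Q'"
      by (simp add: M matrix_diff_ldistrib matrix_diff_rdistrib W'W')
    also have "ctranspose Q' ** (ctranspose W' ** W) ** Q'
      = ctranspose Q' ** Q' ** dg (\<chi> i. cnj (l' $ i)) ** ctranspose Q' ** Q ** dg l ** ctranspose Q ** Q'"
      by (simp add: Q(3) Q'(3) ctranspose_mult ctranspose_dg matrix_mul_assoc)
    also have "\<dots> = dg (\<chi> i. cnj (l' $ i)) ** (R ** dg l ** ctranspose R)"
      by (simp add: R Q'Q' ctranspose_mult matrix_mul_assoc)
    finally show ?thesis by (simp add: Q'Q')
  qed
  have Mjj: "M $ j $ j = (\<Sum>k\<in>UNIV. of_real (P k) * (1 - cnj (l' $ j) * l $ k))"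
  proof -
    have "M $ j $ j = 1 - cnj (l' $ j) * (\<Sum>k\<in>UNIV. of_real (P k) * l $ k)"
      unfolding M1 by (simp add: mat_def conj_dg_diag P_def)
    also have "1 = (\<Sum>k\<in>UNIV. complex_of_real (P k))"
      by (simp only: Psum flip: of_real_sum) simp
    finally show ?thesis
      by (simp add: sum_distrib_left algebra_simps sum_subtractf)
  qed
  \<comment> \<open>Source of the quadratic error: for unitary \<open>W\<close> and
    \<open>W'\<close> the Hermitian part of \<open>ctranspose W' ** (W' - W)\<close> is half of
    \<open>ctranspose N ** N\<close>, so the real part of a diagonal entry of \<open>M\<close> is
    half the squared norm of a column of \<open>N ** Q'\<close>.\<close>
  have ReM: "Re (M $ j $ j) \<le> (norm (W' - W))\<^sup>2 / 2"
  proof -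
    define N where "N = W' - W"
    have WW: "ctranspose W ** W = mat 1"
      using Q by (metis unitary_def unitary_mult unitary_ctranspose unitary_dg)
    have "ctranspose N ** N = ctranspose W' ** N + ctranspose (ctranspose W' ** N)"
      by (simp add: N_def ctranspose_mult ctranspose_diff matrix_diff_ldistrib matrix_diff_rdistrib
          W'W' WW)
    then have "ctranspose (N ** Q') ** (N ** Q') =
        ctranspose Q' ** (ctranspose W' ** N + ctranspose (ctranspose W' ** N)) ** Q'"
      by (simp add: ctranspose_mult matrix_mul_assoc) (simp flip: matrix_mul_assoc)
    also have "\<dots> = M + ctranspose M"
      by (simp add: M N_def ctranspose_mult matrix_add_ldistrib matrix_add_rdistrib matrix_mul_assoc)
    finally have "(ctranspose (N ** Q') ** (N ** Q')) $ j $ j = of_real (2 * Re (M $ j $ j))"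
      by (simp add: complex_add_cnj)
    moreover have "(ctranspose (N ** Q') ** (N ** Q')) $ j $ j
        = of_real (\<Sum>i\<in>UNIV. (norm ((N ** Q') $ i $ j))\<^sup>2)"
      by (subst matrix_mult_nth) (simp add: complex_norm_square mult.commute del: of_real_power)
    ultimately have "2 * Re (M $ j $ j) = (\<Sum>i\<in>UNIV. (norm ((N ** Q') $ i $ j))\<^sup>2)"
      by (metis of_real_eq_iff)
    also have "\<dots> \<le> (norm (N ** Q'))\<^sup>2"
      unfolding norm_matrix_sq by (intro sum_mono member_le_sum) auto
    finally show ?thesis by (simp add: norm_mult_unitary[OF Q'(1)] N_def)
  qed
  \<comment> \<open>The slope \<open>p\<close> belongs to \<open>l' $ j\<close> alone and does not
    depend on \<open>k\<close>, so it can be pulled out of the average over \<open>k\<close>,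
    leaving the imaginary part of one entry of \<open>M\<close>.\<close>
  obtain p where p: "\<bar>p\<bar> \<le> 1" and gp: "\<And>\<mu>. norm \<mu> = 1 \<Longrightarrow>
      g (l' $ j) \<le> g \<mu> + p * Im (l' $ j * cnj \<mu>) + C * (1 - Re (l' $ j * cnj \<mu>))"
    using semi[OF Q'(2)[of j]] by blast
  have "g (l' $ j) = (\<Sum>k\<in>UNIV. P k * g (l' $ j))"
    by (simp add: Psum flip: sum_distrib_right)
  also have "\<dots> \<le> (\<Sum>k\<in>UNIV. P k * (g (l $ k) + p * Im (l' $ j * cnj (l $ k))
      + C * (1 - Re (l' $ j * cnj (l $ k)))))"
    by (intro sum_mono mult_left_mono gp Q Pnn)
  also have "\<dots> = (\<Sum>k\<in>UNIV. P k * g (l $ k))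
      + p * (\<Sum>k\<in>UNIV. P k * Im (l' $ j * cnj (l $ k)))
      + C * (\<Sum>k\<in>UNIV. P k * (1 - Re (l' $ j * cnj (l $ k))))"
    by (simp only: distrib_left sum.distrib sum_distrib_left mult.left_commute)
  also have "(\<Sum>k\<in>UNIV. P k * Im (l' $ j * cnj (l $ k))) = Im (M $ j $ j)"
    unfolding Mjj by (simp add: algebra_simps)
  also have "(\<Sum>k\<in>UNIV. P k * (1 - Re (l' $ j * cnj (l $ k)))) = Re (M $ j $ j)"
    unfolding Mjj by (simp add: algebra_simps)
  also have "p * Im (M $ j $ j) \<le> norm (M $ j $ j)"
  proof -
    have "p * Im (M $ j $ j) \<le> \<bar>p\<bar> * \<bar>Im (M $ j $ j)\<bar>"
      by (metis abs_ge_self abs_mult)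
    also have "\<dots> \<le> 1 * norm (M $ j $ j)"
      by (intro mult_mono p abs_Im_le_cmod) auto
    finally show ?thesis by simp
  qed
  also have "C * Re (M $ j $ j) \<le> C * ((norm (W' - W))\<^sup>2 / 2)"
    by (intro mult_left_mono C ReM)
  also have "(\<Sum>k\<in>UNIV. P k * g (l $ k)) = Re ((R ** dg (angles g l) ** ctranspose R) $ j $ j)"
    by (simp add: conj_dg_diag P_def)
  finally show ?thesis by simp
qed

text \<open>The new angle vector is dominated entrywise by the diagonal of a conjugate of the old
  one plus the velocity part \<open>v\<close>. Monotonicity permits the replacement, the perspective
  inequality separates the two summands, and pinching with unitary invariance removes the unknown
  eigenbases from each. The hypothesis \<open>pert\<close> isolates the absorption of the quadratic
  error, which uniform continuity of \<open>L\<close> provides for short steps.\<close>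

lemma angle_bound_step:
  fixes L :: "complex^'n^'n \<Rightarrow> real" and W W' :: "complex^'n^'n" and g :: "complex \<Rightarrow> real"
  assumes L: "symmetric_lagrangian L" and C: "0 \<le> C" and g: "\<And>\<mu>. 0 \<le> g \<mu>"
    and semi: "\<And>\<kappa>. norm \<kappa> = 1 \<Longrightarrow> \<exists>p. \<bar>p\<bar> \<le> 1 \<and> (\<forall>\<mu>. norm \<mu> = 1 \<longrightarrow>
       g \<kappa> \<le> g \<mu> + p * Im (\<kappa> * cnj \<mu>) + C * (1 - Re (\<kappa> * cnj \<mu>)))"
    and te: "0 \<le> t" "0 < e" and W: "unitary W" and ab: "angle_bound L g t W s"
    and pert: "\<And>d. norm d \<le> norm (W' - W) / e \<Longrightarrow>
       L (dg (\<chi> j. of_real (norm (d $ j) + C * (norm (W' - W))\<^sup>2 / (2 * e)))) \<le> L (dg d) + \<omega>"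
  shows "angle_bound L g (t + e) W' (s + e * (L ((W' - W) /\<^sub>R e) + \<omega>))"
  unfolding angle_bound_def
proof (intro allI impI)
  fix Q' l'
  assume Q': "unitary Q'" "\<forall>i. norm (l' $ i) = 1" "W' = Q' ** dg l' ** ctranspose Q'"
  obtain Q l where Q: "unitary Q" "\<And>i. norm (l $ i) = 1" "W = Q ** dg l ** ctranspose Q"
    using unitary_diagonalization[OF W] by metis
  define R where "R = ctranspose Q' ** Q"
  define M where "M = ctranspose Q' ** (ctranspose W' ** (W' - W)) ** Q'"
  define Y where "Y = R ** dg (angles g l) ** ctranspose R"
  define c where "c = C * (norm (W' - W))\<^sup>2 / 2"
  have uR: "unitary R"
    unfolding R_def by (intro unitary_mult unitary_ctranspose Q Q')
  have uW': "unitary W'"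
    unfolding Q'(3) using Q' by (intro unitary_mult unitary_ctranspose unitary_dg) auto
  have old: "t = 0 \<longrightarrow> angles g l = 0" "t * L (dg (angles g l) /\<^sub>R t) \<le> s"
    using ab Q unfolding angle_bound_def by blast+
  have step: "g (l' $ j) \<le> Re (Y $ j $ j) + norm (M $ j $ j) + c" for j
    unfolding Y_def c_def
    using eigenvalue_angle_step[OF C semi Q Q'(1) _ Q'(3) R_def M_def, of j] Q'(2) by blast
  have "Y $ j $ j = of_real (Re (Y $ j $ j))" and Yge: "0 \<le> Re (Y $ j $ j)" for j
    unfolding Y_def conj_dg_diag using g by (auto simp: complex_eq_iff intro!: sum_nonneg)
  define v where "v = (\<chi> j. complex_of_real (norm (M $ j $ j) + c))"
  have c: "0 \<le> c" using C by (simp add: c_def)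
  have "(t + e) * L (dg (angles g l') /\<^sub>R (t + e)) = (t + e) * L (dg (angles g l' /\<^sub>R (t + e)))"
    by (simp add: dg_scaleR)
  also have "\<dots> \<le> (t + e) * L (dg ((diag Y + v) /\<^sub>R (t + e)))"
  proof (intro mult_left_mono lagrangian_dg_mono[OF L])
    fix j
    have "norm (angles g l' $ j) = g (l' $ j)" using g by simp
    also have "\<dots> \<le> Re (Y $ j $ j) + norm (M $ j $ j) + c" by (rule step)
    also have "\<dots> = norm (of_real (Re (Y $ j $ j) + norm (M $ j $ j) + c) :: complex)"
      using Yge[of j] c by (simp only: norm_of_real) simp
    also have "of_real (Re (Y $ j $ j) + norm (M $ j $ j) + c) = (diag Y + v) $ j"
      by (subst \<open>Y $ j $ j = _\<close>) (simp add: v_def \<open>Y $ j $ j = _\<close>[symmetric])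
    finally show "norm ((angles g l' /\<^sub>R (t + e)) $ j) \<le> norm (((diag Y + v) /\<^sub>R (t + e)) $ j)"
      using te by (simp add: divide_right_mono norm_divide mult_left_mono)
  qed (use te in auto)
  also have "dg ((diag Y + v) /\<^sub>R (t + e)) = (dg (diag Y) + dg v) /\<^sub>R (t + e)"
    by (simp add: dg_scaleR dg_add)
  also have "(t + e) * L ((dg (diag Y) + dg v) /\<^sub>R (t + e)) \<le> t * L (dg (diag Y) /\<^sub>R t) + e * L (dg v /\<^sub>R e)"
    by (rule lagrangian_perspective[OF L te]) (use old in \<open>auto simp: Y_def conj_dg_diag vec_eq_iff\<close>)
  also have "dg (diag Y) /\<^sub>R t = dg (diag (Y /\<^sub>R t))"
    by (simp add: diag_scaleR dg_scaleR)
  also have "L (dg (diag (Y /\<^sub>R t))) \<le> L (Y /\<^sub>R t)"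
    by (rule lagrangian_pinching[OF L])
  also have "L (Y /\<^sub>R t) = L (dg (angles g l) /\<^sub>R t)"
    using lagrangian_conj[OF L uR, of "dg (angles g l) /\<^sub>R t"]
    by (simp add: Y_def matrix_mult_scaleR_left matrix_mult_scaleR_right)
  also have "L (dg v /\<^sub>R e) \<le> L ((W' - W) /\<^sub>R e) + \<omega>"
  proof -
    define d where "d = diag (M /\<^sub>R e)"
    have normM: "norm M = norm (W' - W)"
      using uW' Q' by (simp add: M_def norm_mult_unitary norm_unitary_mult unitary_ctranspose)
    have "norm d \<le> norm (M /\<^sub>R e)" unfolding d_def by (rule norm_diag_le)
    then have "norm d \<le> norm (W' - W) / e"
      using te by (simp add: normM divide_inverse mult.commute)
    then have "L (dg (\<chi> j. of_real (norm (d $ j) + C * (norm (W' - W))\<^sup>2 / (2 * e)))) \<le> L (dg d) + \<omega>"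
      by (rule pert)
    also have "dg (\<chi> j. of_real (norm (d $ j) + C * (norm (W' - W))\<^sup>2 / (2 * e))) = dg v /\<^sub>R e"
    proof -
      have "norm (d $ j) + C * (norm (W' - W))\<^sup>2 / (2 * e) = inverse e * (norm (M $ j $ j) + c)" for j
        using te by (simp add: d_def c_def field_simps)
      then show ?thesis
        unfolding dg_scaleR[symmetric] v_def dg_inject
        unfolding vec_eq_iff vector_scaleR_component vec_lambda_beta
        unfolding scaleR_conv_of_real by simp
    qed
    also have "L (dg d) \<le> L (M /\<^sub>R e)"
      unfolding d_def by (rule lagrangian_pinching[OF L])
    also have "M /\<^sub>R e = ctranspose Q' ** (ctranspose W' ** ((W' - W) /\<^sub>R e)) ** Q'"
      by (simp add: M_def matrix_mult_scaleR_left matrix_mult_scaleR_right)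
    also have "L \<dots> = L ((W' - W) /\<^sub>R e)"
      using uW' Q' by (simp add: lagrangian_unitary[OF L] lagrangian_unitary_left[OF L] unitary_ctranspose)
    finally show ?thesis by simp
  qed
  also have "t * L (dg (angles g l) /\<^sub>R t) \<le> s" by (rule old)
  finally show "(t + e = 0 \<longrightarrow> angles g l' = 0) \<and>
      (t + e) * L (dg (angles g l') /\<^sub>R (t + e)) \<le> s + e * (L ((W' - W) /\<^sub>R e) + \<omega>)"
    using te by (simp add: mult_left_mono)
qed

section \<open>The lower bound for the action\<close>

lemma angle_bound_mono: "angle_bound L g t W s \<Longrightarrow> s \<le> s' \<Longrightarrow> angle_bound L g t W s'"
  unfolding angle_bound_def by (intro allI impI) (blast intro: order_trans)

lemma angle_bound_limit:
  assumes "\<And>\<omega>. 0 < \<omega> \<Longrightarrow> angle_bound L g t W (s + \<omega>)"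
  shows "angle_bound L g t W s"
  unfolding angle_bound_def
proof (intro allI impI)
  fix Q l
  assume "unitary Q" "\<forall>i. norm (l $ i) = 1" "W = Q ** dg l ** ctranspose Q"
  with assms have "(t = 0 \<longrightarrow> angles g l = 0) \<and> t * L (dg (angles g l) /\<^sub>R t) \<le> s + \<omega>" if "0 < \<omega>" for \<omega>
    using that unfolding angle_bound_def by blast
  then show "(t = 0 \<longrightarrow> angles g l = 0) \<and> t * L (dg (angles g l) /\<^sub>R t) \<le> s"
    by (meson field_le_epsilon zero_less_one)
qed

text \<open>Used with \<open>c = 0\<close> to bound a difference quotient by the maximal speed, and
  with \<open>c\<close> a velocity to compare the quotient with it.\<close>

lemma difference_quotient_bound:
  fixes f :: "real \<Rightarrow> 'a::banach"
  assumes "t1 < t2"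
    and deriv: "\<And>t. t \<in> {t1..t2} \<Longrightarrow> (f has_vector_derivative D t) (at t within {t1..t2})"
    and "\<And>t. t \<in> {t1..t2} \<Longrightarrow> norm (D t - c) \<le> \<eta>"
  shows "norm ((f t2 - f t1) /\<^sub>R (t2 - t1) - c) \<le> \<eta>"
proof -
  have "(D has_integral f t2 - f t1) {t1..t2}"
    using assms by (intro fundamental_theorem_of_calculus) auto
  then have "((\<lambda>t. D t - c) has_integral f t2 - f t1 - (t2 - t1) *\<^sub>R c) {t1..t2}"
    using has_integral_const_real[of c t1 t2] assms(1) by (intro has_integral_diff) auto
  then have "norm (f t2 - f t1 - (t2 - t1) *\<^sub>R c) \<le> \<eta> * (t2 - t1)"
    using has_integral_bound_real[of \<eta> "{}" "\<lambda>t. D t - c" _ t1 t2] assms(1) assms(3)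
      order_trans[OF norm_ge_zero assms(3)[of t1]] by simp
  moreover have "(f t2 - f t1) /\<^sub>R (t2 - t1) - c = (f t2 - f t1 - (t2 - t1) *\<^sub>R c) /\<^sub>R (t2 - t1)"
    using assms(1) by (simp add: scaleR_diff_right)
  ultimately show ?thesis
    using assms(1) by (simp add: divide_inverse[symmetric] mult.commute[of "inverse _"] divide_le_eq)
qed

text \<open>A step of length \<open>e\<close> has an error of order \<open>e^2\<close> in the
  angles, that is of order \<open>e\<close> inside \<open>L\<close> after division by
  \<open>e\<close>. All velocities and quotients stay in one ball, so uniform continuity of
  \<open>L\<close> makes the loss per unit of time as small as desired.\<close>

lemma angle_bound_C1:
  fixes L :: "complex^'n^'n \<Rightarrow> real" and W D :: "real \<Rightarrow> complex^'n^'n" and g :: "complex \<Rightarrow> real"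
  assumes L: "symmetric_lagrangian L" and C: "0 \<le> C" and g: "\<And>\<mu>. 0 \<le> g \<mu>"
    and semi: "\<And>\<kappa>. norm \<kappa> = 1 \<Longrightarrow> \<exists>p. \<bar>p\<bar> \<le> 1 \<and> (\<forall>\<mu>. norm \<mu> = 1 \<longrightarrow>
       g \<kappa> \<le> g \<mu> + p * Im (\<kappa> * cnj \<mu>) + C * (1 - Re (\<kappa> * cnj \<mu>)))"
    and ac: "0 \<le> a" "a < c" and D: "continuous_on {a..c} D"
    and deriv: "\<And>t. t \<in> {a..c} \<Longrightarrow> (W has_vector_derivative D t) (at t within {a..c})"
    and W: "\<And>t. t \<in> {a..c} \<Longrightarrow> unitary (W t)"
    and ab: "angle_bound L g a (W a) s"
  shows "angle_bound L g c (W c) (s + integral {a..c} (\<lambda>t. L (D t)))"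
proof (rule angle_bound_limit)
  fix \<omega>0 :: real assume "0 < \<omega>0"
  \<comment> \<open>Each unit of time costs \<open>2 * \<omega>\<close>: once for replacing the
    velocity by a difference quotient, once for the quadratic error of the angles.\<close>
  define \<omega> where "\<omega> = \<omega>0 / (2 * (c - a))"
  have \<omega>: "0 < \<omega>" "2 * \<omega> * (c - a) = \<omega>0"
    using \<open>0 < \<omega>0\<close> ac by (auto simp: \<omega>_def field_simps)
  have "compact (D ` {a..c})" using D by (intro compact_continuous_image) auto
  then have "bounded (D ` {a..c})" by (rule compact_imp_bounded)
  then obtain B where B: "0 < B" "\<And>t. t \<in> {a..c} \<Longrightarrow> norm (D t) \<le> B"
    by (auto simp: bounded_pos)
  \<comment> \<open>The velocities have norm at most \<open>B\<close>; the extra 1 leaves room for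
    the perturbation by the quadratic error.\<close>
  have "uniformly_continuous_on (cball 0 (B + 1)) L"
    by (intro compact_uniformly_continuous continuous_on_subset[OF lagrangian_continuous[OF L]]) auto
  then obtain \<delta>1 where "0 < \<delta>1" and
    unif: "\<And>Y X. Y \<in> cball 0 (B + 1) \<Longrightarrow> X \<in> cball 0 (B + 1) \<Longrightarrow> dist X Y < \<delta>1 \<Longrightarrow> dist (L X) (L Y) < \<omega>"
    using \<omega>(1) by (rule uniformly_continuous_onE) (rule that, assumption, blast)
  have \<delta>1: "0 < \<delta>1"
    "\<And>X Y. norm X \<le> B + 1 \<Longrightarrow> norm Y \<le> B + 1 \<Longrightarrow> norm (X - Y) < \<delta>1 \<Longrightarrow> L X \<le> L Y + \<omega>"
  proof -
    fix X Y :: "complex^'n^'n"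
    assume "norm X \<le> B + 1" "norm Y \<le> B + 1" "norm (X - Y) < \<delta>1"
    then have "\<bar>L X - L Y\<bar> < \<omega>"
      using unif[of Y X] by (simp add: dist_norm)
    then show "L X \<le> L Y + \<omega>" by linarith
  qed fact
  have "uniformly_continuous_on {a..c} D"
    using D by (intro compact_uniformly_continuous) auto
  then obtain \<delta>2 where "0 < \<delta>2" and
    unif2: "\<And>t t'. t \<in> {a..c} \<Longrightarrow> t' \<in> {a..c} \<Longrightarrow> dist t' t < \<delta>2 \<Longrightarrow> dist (D t') (D t) < \<delta>1 / 2"
    using half_gt_zero[OF \<delta>1(1)] by (rule uniformly_continuous_onE) (rule that, assumption, blast)
  have \<delta>2: "0 < \<delta>2"
    "\<And>t t'. t \<in> {a..c} \<Longrightarrow> t' \<in> {a..c} \<Longrightarrow> \<bar>t - t'\<bar> < \<delta>2 \<Longrightarrow> norm (D t - D t') < \<delta>1 / 2"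
    using \<open>0 < \<delta>2\<close> unif2 by (simp_all add: dist_norm)
  define n1 where "n1 = norm (\<chi> j :: 'n. (1 :: complex))"
  \<comment> \<open>The first bound keeps the velocity nearly constant during a step. The second
    keeps the perturbation, a constant vector of norm at most \<open>C * B^2 * n1 * e\<close>, below
    both \<open>\<delta>1\<close> and 1; the \<open>+ 1\<close> in the denominator keeps it
    positive.\<close>
  define \<delta> where "\<delta> = min \<delta>2 (min \<delta>1 1 / (C * B\<^sup>2 * n1 + 1))"
  have den: "0 < C * B\<^sup>2 * n1 + 1"
    using C by (intro add_nonneg_pos) (auto simp: n1_def)
  have \<delta>: "0 < \<delta>" using \<delta>1 \<delta>2 den by (auto simp: \<delta>_def)
  have small: "(C * B\<^sup>2 * n1) * e < \<delta>1 \<and> (C * B\<^sup>2 * n1) * e < 1" if "0 < e" "e < \<delta>" for e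
  proof -
    have "e * (C * B\<^sup>2 * n1 + 1) < min \<delta>1 1"
      using that den by (simp add: \<delta>_def less_divide_eq)
    moreover have "(C * B\<^sup>2 * n1) * e \<le> e * (C * B\<^sup>2 * n1 + 1)"
      using that by (simp add: algebra_simps)
    ultimately show ?thesis by linarith
  qed
  have LD: "continuous_on {a..c} (\<lambda>t. L (D t))"
    using continuous_on_compose2[OF lagrangian_continuous[OF L] D] by auto
  have step: "angle_bound L g t2 (W t2) (s' + (integral {t1..t2} (\<lambda>t. L (D t)) + 2 * \<omega> * (t2 - t1)))"
    if t: "a \<le> t1" "t1 < t2" "t2 \<le> c" "t2 - t1 < \<delta>" and bd: "angle_bound L g t1 (W t1) s'" for t1 t2 s'
  proof -
    define e where "e = t2 - t1"
    have e: "0 < e" "e < \<delta>" using t by (auto simp: e_def)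
    define X where "X = (W t2 - W t1) /\<^sub>R e"
    have dW: "(W has_vector_derivative D t) (at t within {t1..t2})" if "t \<in> {t1..t2}" for t
      using that t by (intro has_vector_derivative_within_subset[OF deriv]) auto
    have X_bound: "norm X \<le> B"
      using difference_quotient_bound[OF t(2) dW, of 0 B] B(2) t by (simp add: X_def e_def)
    have X_near: "L X \<le> L (D t) + \<omega>" if "t \<in> {t1..t2}" for t
    proof (rule \<delta>1(2))
      have "norm (X - D t) \<le> \<delta>1 / 2"
        unfolding X_def e_def
      proof (rule difference_quotient_bound[OF t(2) dW])
        fix t' assume "t' \<in> {t1..t2}"
        then have "norm (D t' - D t) < \<delta>1 / 2"
          using that t e by (intro \<delta>2(2)) (auto simp: \<delta>_def e_def)
        then show "norm (D t' - D t) \<le> \<delta>1 / 2" by simp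
      qed
      then show "norm (X - D t) < \<delta>1" using \<delta>1(1) by simp
    qed (use X_bound B(2)[of t] that t in auto)
    have bound: "angle_bound L g (t1 + e) (W t2) (s' + e * (L X + \<omega>))"
      unfolding X_def
    proof (rule angle_bound_step[OF L C g semi _ e(1) W bd])
      fix d :: "complex^'n"
      assume "norm d \<le> norm (W t2 - W t1) / e"
      also have "\<dots> = norm X"
        using e by (simp add: X_def divide_inverse mult.commute)
      finally have d: "norm d \<le> B" using X_bound by linarith
      have normW: "norm (W t2 - W t1) = e * norm X" using e by (simp add: X_def)
      define r where "r = C * (norm (W t2 - W t1))\<^sup>2 / (2 * e)"
      define ad where "ad = (\<chi> j. complex_of_real (norm (d $ j)))"
      have nad: "norm ad = norm d" by (simp add: ad_def norm_vec_def)
      have r: "r = C * (norm X)\<^sup>2 * e / 2"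
        using e by (simp add: r_def normW power_mult_distrib power2_eq_square)
      have "norm (\<chi> j :: 'n. complex_of_real r) = norm (r *\<^sub>R (\<chi> j :: 'n. (1 :: complex)))"
        by (rule arg_cong[where f = norm]) (simp add: vec_eq_iff of_real_def)
      also have "\<dots> = \<bar>r\<bar> * n1" by (simp add: n1_def)
      also have "\<dots> \<le> C * B\<^sup>2 * n1 * e"
      proof -
        have "(norm X)\<^sup>2 \<le> B\<^sup>2" using X_bound by (intro power_mono) auto
        then have "C * (norm X)\<^sup>2 * e \<le> C * B\<^sup>2 * e"
          using C e by (intro mult_right_mono mult_left_mono) auto
        moreover have "0 \<le> C * (norm X)\<^sup>2 * e" using C e by simp
        ultimately have "\<bar>r\<bar> \<le> C * B\<^sup>2 * e" by (simp add: r)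
        then have "\<bar>r\<bar> * n1 \<le> C * B\<^sup>2 * e * n1" by (intro mult_right_mono) (auto simp: n1_def)
        then show ?thesis by (simp add: mult_ac)
      qed
      finally have nr: "norm (\<chi> j :: 'n. complex_of_real r) \<le> C * B\<^sup>2 * n1 * e" .
      have eq: "(\<chi> j. complex_of_real (norm (d $ j) + r)) = ad + (\<chi> j. of_real r)"
        by (simp add: vec_eq_iff ad_def)
      have "L (dg (\<chi> j. complex_of_real (norm (d $ j) + r))) \<le> L (dg ad) + \<omega>"
        unfolding eq
      proof (rule \<delta>1(2))
        show "norm (dg ad) \<le> B + 1" using d nad by (simp add: norm_dg)
        show "norm (dg (ad + (\<chi> j. complex_of_real r))) \<le> B + 1"
          using norm_triangle_ineq[of ad "\<chi> j. complex_of_real r"] nr small[OF e] d nad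
          by (simp add: norm_dg)
        show "norm (dg (ad + (\<chi> j. complex_of_real r)) - dg ad) < \<delta>1"
          using nr small[OF e] by (simp add: dg_add norm_dg)
      qed
      also have "L (dg ad) = L (dg d)"
        by (rule lagrangian_dg_cong[OF L]) (simp add: ad_def)
      finally show "L (dg (\<chi> j. of_real (norm (d $ j) + C * (norm (W t2 - W t1))\<^sup>2 / (2 * e)))) \<le> L (dg d) + \<omega>"
        by (simp add: r_def)
    qed (use t ac in auto)
    have ineq: "e * (L X + \<omega>) \<le> integral {t1..t2} (\<lambda>t. L (D t)) + 2 * \<omega> * e"
    proof -
      have "integral {t1..t2} (\<lambda>t. L X - \<omega>) \<le> integral {t1..t2} (\<lambda>t. L (D t))"
        using X_near t
        by (intro integral_le integrable_continuous_interval continuous_on_subset[OF LD])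
          (auto simp: diff_le_eq)
      then show ?thesis using t by (simp add: e_def algebra_simps)
    qed
    have "angle_bound L g (t1 + e) (W t2) (s' + (integral {t1..t2} (\<lambda>t. L (D t)) + 2 * \<omega> * e))"
      using bound by (rule angle_bound_mono) (use ineq in simp)
    then show ?thesis by (simp add: e_def)
  qed
  obtain N :: nat where N: "(c - a) / \<delta> < real N"
    using reals_Archimedean2 by blast
  then have N0: "0 < real N"
    using ac \<delta> by (smt (verit) divide_pos_pos)
  define h where "h = (c - a) / real N"
  have h: "0 < h" "h < \<delta>" "real N * h = c - a"
    using N N0 ac \<delta> by (auto simp: h_def field_simps)
  have "i \<le> N \<longrightarrow> angle_bound L g (a + real i * h) (W (a + real i * h))
      (s + (integral {a..a + real i * h} (\<lambda>t. L (D t)) + 2 * \<omega> * (real i * h)))" for i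
  proof (induction i)
    case 0
    show ?case using ab by simp
  next
    case (Suc i)
    show ?case
    proof
      assume le: "Suc i \<le> N"
      let ?t = "a + real i * h" and ?t' = "a + real (Suc i) * h"
      have "real (Suc i) * h \<le> real N * h" using le h by (intro mult_right_mono) auto
      then have t': "?t' \<le> c" using h by simp
      have tt: "a \<le> ?t" "?t < ?t'" "?t' - ?t < \<delta>" "?t' - ?t = h"
        using h by (auto simp: algebra_simps)
      have "integral {a..?t'} (\<lambda>t. L (D t)) = integral {a..?t} (\<lambda>t. L (D t)) + integral {?t..?t'} (\<lambda>t. L (D t))"
        using tt t' by (intro Henstock_Kurzweil_Integration.integral_combine[symmetric]
            integrable_continuous_interval continuous_on_subset[OF LD]) auto
      moreover have "2 * \<omega> * (real (Suc i) * h) = 2 * \<omega> * (real i * h) + 2 * \<omega> * (?t' - ?t)"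
        by (simp add: algebra_simps)
      ultimately show "angle_bound L g ?t' (W ?t')
          (s + (integral {a..?t'} (\<lambda>t. L (D t)) + 2 * \<omega> * (real (Suc i) * h)))"
        using step[OF tt(1,2) t' tt(3), of "s + (integral {a..?t} (\<lambda>t. L (D t)) + 2 * \<omega> * (real i * h))"]
          Suc.IH le by (simp add: add.assoc add.left_commute)
    qed
  qed
  from this[of N] have "angle_bound L g c (W c) (s + (integral {a..c} (\<lambda>t. L (D t)) + 2 * \<omega> * (c - a)))"
    by (simp add: h(3))
  then show "angle_bound L g c (W c) (s + integral {a..c} (\<lambda>t. L (D t)) + \<omega>0)"
    by (simp add: \<omega>(2) add.assoc)
qed

text \<open>The derivative is offered in two forms: the one-sided one on the closed piece feeds
  estimates on that piece, and the two-sided one in the interior identifies the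
  \<open>vector_derivative\<close> that occurs in the action.\<close>

lemma piecewise_C1_induct [consumes 1, case_names base step]:
  assumes "piecewise_C1 f a b"
    and base: "P a"
    and step: "\<And>c d D. a \<le> c \<Longrightarrow> c < d \<Longrightarrow> d \<le> b \<Longrightarrow> continuous_on {c..d} D \<Longrightarrow>
      (\<And>t. t \<in> {c..d} \<Longrightarrow> (f has_vector_derivative D t) (at t within {c..d})) \<Longrightarrow>
      (\<And>t. t \<in> {c<..<d} \<Longrightarrow> (f has_vector_derivative D t) (at t)) \<Longrightarrow> P c \<Longrightarrow> P d"
  shows "P b"
proof -
  obtain m p where p: "p (0::nat) = a" "p m = b"
    "\<And>i. i < m \<Longrightarrow> p i < p (Suc i)" "\<And>i. i < m \<Longrightarrow> C1_on_interval f (p i) (p (Suc i))"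
    using assms(1) unfolding piecewise_C1_def by blast
  have mono: "i \<le> j \<Longrightarrow> j \<le> m \<Longrightarrow> p i \<le> p j" for i j
  proof (induction j)
    case (Suc j)
    then show ?case using p(3)[of j] by (cases "i = Suc j") auto
  qed simp
  have "i \<le> m \<Longrightarrow> P (p i)" for i
  proof (induction i)
    case (Suc i)
    obtain D where D: "continuous_on {p i..p (Suc i)} D"
      "\<And>t. t \<in> {p i..p (Suc i)} \<Longrightarrow> (f has_vector_derivative D t) (at t within {p i..p (Suc i)})"
      using p(4)[of i] Suc.prems unfolding C1_on_interval_def by auto
    show ?case
    proof (rule step[OF _ _ _ D])
      show "a \<le> p i" "p (Suc i) \<le> b"
        using mono[of 0 i] mono[of "Suc i" m] Suc.prems p(1,2) by auto
      show "(f has_vector_derivative D t) (at t)" if "t \<in> {p i<..<p (Suc i)}" for t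
        using D(2)[of t] that at_within_Icc_at[of "p i" t "p (Suc i)"] by simp
    qed (use Suc p in auto)
  qed (use base p in simp)
  then show ?thesis using p(2) by auto
qed

text \<open>Replaces the integrand of an action on one piece by a continuous one. The two may
  disagree at \<open>c\<close> and \<open>d\<close>, where the one-sided derivatives of neighbouring
  pieces need not match.\<close>

lemma piece_integral:
  fixes F :: "'a::real_normed_vector \<Rightarrow> real"
  assumes cd: "a \<le> c" "c < d" "d \<le> b" and D: "continuous_on {c..d} D"
    and deriv: "\<And>t. t \<in> {c<..<d} \<Longrightarrow> (f has_vector_derivative D t) (at t)"
    and F: "continuous_on UNIV F"
  shows "((\<lambda>t. F (vector_derivative f (at t within {a..b}))) has_integral
    integral {c..d} (\<lambda>t. F (D t))) {c..d}"
proof -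
  have "continuous_on {c..d} (\<lambda>t. F (D t))"
    using continuous_on_compose2[OF F D] by auto
  then have "((\<lambda>t. F (D t)) has_integral integral {c..d} (\<lambda>t. F (D t))) {c..d}"
    by (intro integrable_integral integrable_continuous_interval)
  then show ?thesis
  proof (rule has_integral_spike_finite[where S = "{c, d}", rotated 2])
    show "F (vector_derivative f (at t within {a..b})) = F (D t)" if "t \<in> {c..d} - {c, d}" for t
    proof -
      have "t \<in> {c<..<d}" "a < t" "t < b" using that cd by auto
      then show ?thesis
        using vector_derivative_at[OF deriv] at_within_Icc_at[of a t b] by simp
    qed
  qed simp
qed

lemma speed_integrable:
  fixes F :: "'a::real_normed_vector \<Rightarrow> real"
  assumes "piecewise_C1 f a b" and F: "continuous_on UNIV F"
  shows "(\<lambda>t. F (vector_derivative f (at t within {a..b}))) integrable_on {a..b}"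
proof -
  define v where "v t = vector_derivative f (at t within {a..b})" for t
  have "(\<lambda>t. F (v t)) integrable_on {a..b}"
    using assms(1)
  proof (induction rule: piecewise_C1_induct)
    case (step c d D)
    have "((\<lambda>t. F (v t)) has_integral integral {c..d} (\<lambda>t. F (D t))) {c..d}"
      unfolding v_def by (rule piece_integral[OF step(1-4,6) F])
    with step(1,2,7) show ?case
      by (intro Henstock_Kurzweil_Integration.integrable_combine[of a c d]) (auto simp: has_integral_iff)
  qed (use integrable_on_refl[of _ a] in simp)
  then show ?thesis by (simp add: v_def)
qed

text \<open>Translation by the adjoint of \<open>U\<close> preserves \<open>L\<close> of the
  velocity and moves the starting point to the identity, all of whose angles vanish. At the end
  point the angles lie in the range where \<open>g\<close> is exact, so the accumulated bound is the
  value claimed.\<close>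

theorem action_lower_bound:
  fixes L :: "complex^'n^'n \<Rightarrow> real"
  assumes L: "symmetric_lagrangian L" and b: "0 < b"
    and \<alpha>: "unitary_curve b U V \<alpha>" and U: "unitary U" and Q: "unitary Q"
    and V: "V = U ** (Q ** dg (\<chi> j. cis (z j)) ** ctranspose Q)"
    and m: "0 \<le> m" "m < pi" and z: "\<And>j. \<bar>z j\<bar> \<le> m"
  shows "b * L (dg (\<chi> j. of_real (z j)) /\<^sub>R b) \<le> action L b \<alpha>"
proof -
  obtain g :: "complex \<Rightarrow> real" and C where C: "0 \<le> C" and g: "\<And>\<mu>. 0 \<le> g \<mu>"
    and gcis: "\<And>s. \<bar>s\<bar> \<le> m \<Longrightarrow> g (cis s) = \<bar>s\<bar>"
    and semi: "\<And>\<kappa>. norm \<kappa> = 1 \<Longrightarrow> \<exists>p. \<bar>p\<bar> \<le> 1 \<and> (\<forall>\<mu>. norm \<mu> = 1 \<longrightarrow>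
       g \<kappa> \<le> g \<mu> + p * Im (\<kappa> * cnj \<mu>) + C * (1 - Re (\<kappa> * cnj \<mu>)))"
    using semiconvex_angle_function[OF m] by metis
  define W where "W t = ctranspose U ** \<alpha> t" for t
  define v where "v t = vector_derivative \<alpha> (at t within {0..b})" for t
  have pw: "piecewise_C1 \<alpha> 0 b" and un: "\<And>t. t \<in> {0..b} \<Longrightarrow> unitary (\<alpha> t)"
    and ends: "\<alpha> 0 = U" "\<alpha> b = V"
    using \<alpha> by (auto simp: unitary_curve_def)
  have W0: "W 0 = mat 1" using U by (simp add: W_def ends unitary_def)
  have Wb: "W b = Q ** dg (\<chi> j. cis (z j)) ** ctranspose Q"
    using U unfolding W_def ends V by (simp add: unitary_cancel)
  have "(\<lambda>t. L (v t)) integrable_on {0..b} \<and> angle_bound L g b (W b) (integral {0..b} (\<lambda>t. L (v t)))"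
    using pw
  proof (induction rule: piecewise_C1_induct)
    case base
    have "angle_bound L g 0 (W 0) 0"
      unfolding angle_bound_def W0
    proof (intro allI impI)
      fix Q :: "complex^'n^'n" and l
      assume Q: "unitary Q" and l: "\<forall>i. norm (l $ i) = 1" "mat 1 = Q ** dg l ** ctranspose Q"
      have "dg l = ctranspose Q ** mat 1 ** Q"
        by (rule diagonalization_entry[OF Q l(2)])
      also have "\<dots> = mat 1"
        using Q by (simp add: unitary_def)
      finally have "dg l $ i $ i = mat 1 $ i $ i" for i
        by simp
      then have "l $ i = 1" for i
        by (simp add: mat_def)
      then have "angles g l = 0"
        using gcis[of 0] m by (simp add: vec_eq_iff)
      then show "(0 = 0 \<longrightarrow> angles g l = 0) \<and> 0 * L (dg (angles g l) /\<^sub>R 0) \<le> 0"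
        by simp
    qed
    then show ?case using integrable_on_refl[of _ "0::real"] by simp
  next
    case (step c d D)
    have hi: "((\<lambda>t. L (v t)) has_integral integral {c..d} (\<lambda>t. L (D t))) {c..d}"
      unfolding v_def
      by (rule piece_integral[OF step(1-4,6) lagrangian_continuous[OF L]])
    have int0: "((\<lambda>t. L (v t)) has_integral integral {0..c} (\<lambda>t. L (v t))) {0..c}"
      using step(7) by (simp add: integrable_integral)
    have hid: "((\<lambda>t. L (v t)) has_integral
        integral {0..c} (\<lambda>t. L (v t)) + integral {c..d} (\<lambda>t. L (D t))) {0..d}"
      using has_integral_combine[OF _ _ int0 hi] step(1,2) by simp
    have "angle_bound L g d (W d)
        (integral {0..c} (\<lambda>t. L (v t)) + integral {c..d} (\<lambda>t. L (ctranspose U ** D t)))"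
    proof (rule angle_bound_C1[OF L C g semi step(1,2)])
      show "continuous_on {c..d} (\<lambda>t. ctranspose U ** D t)"
        using bounded_linear.continuous_on[OF bounded_linear_matrix_mult_left step(4)] .
      show "(W has_vector_derivative ctranspose U ** D t) (at t within {c..d})" if "t \<in> {c..d}" for t
        unfolding W_def
        by (rule bounded_linear.has_vector_derivative[OF bounded_linear_matrix_mult_left step(5)[OF that]])
      show "unitary (W t)" if "t \<in> {c..d}" for t
        unfolding W_def using that step(1,3) U by (intro unitary_mult unitary_ctranspose un) auto
    qed (use step(7) in auto)
    moreover have "L (ctranspose U ** D t) = L (D t)" for t
      using lagrangian_unitary_left[OF L unitary_ctranspose[OF U]] .
    ultimately show ?case
      using hid by (auto simp: has_integral_iff)
  qed
  then have "angle_bound L g b (W b) (action L b \<alpha>)"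
    by (simp add: action_def v_def)
  then have "b * L (dg (angles g (\<chi> j. cis (z j))) /\<^sub>R b) \<le> action L b \<alpha>"
    using Q Wb unfolding angle_bound_def by simp
  moreover have "L (dg (angles g (\<chi> j. cis (z j))) /\<^sub>R b) = L (dg (\<chi> j. of_real (z j)) /\<^sub>R b)"
    unfolding dg_scaleR[symmetric]
    by (rule lagrangian_dg_cong[OF L]) (simp add: gcis z)
  ultimately show ?thesis by simp
qed

section \<open>The geodesic\<close>

lemma has_vector_derivative_vec_lambda:
  fixes f :: "'n::finite \<Rightarrow> real \<Rightarrow> complex"
  assumes "\<And>j. (f j has_vector_derivative f' j) (at t within S)"
  shows "((\<lambda>t. \<chi> j. f j t) has_vector_derivative (\<chi> j. f' j)) (at t within S)"
proof -
  have bl: "bounded_linear (axis j :: complex \<Rightarrow> complex^'n)" for j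
    by (intro linear_conv_bounded_linear[THEN iffD1] linearI) (auto simp: vec_eq_iff axis_def)
  have sum_axis: "(\<chi> j. x j) = (\<Sum>j\<in>UNIV. axis j (x j))" for x :: "'n \<Rightarrow> complex"
    by (simp add: vec_eq_iff axis_def)
  show ?thesis
    unfolding sum_axis
    by (intro has_vector_derivative_sum bounded_linear.has_vector_derivative[OF bl] assms)
qed

lemma has_vector_derivative_cis:
  "((\<lambda>t. cis (t * w)) has_vector_derivative \<i> * w * cis (t * w)) (at t within S)"
proof -
  have "cis (s * w) = exp (s *\<^sub>R (\<i> * w))" for s
    by (simp add: cis_conv_exp scaleR_conv_of_real mult_ac)
  then show ?thesis
    using exp_scaleR_has_vector_derivative_right[of "\<i> * w" t S] by (simp add: mult.commute)
qed

lemma mpower_conj_dg: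
  assumes "unitary Q"
  shows "mpower (Q ** dg d ** ctranspose Q) k = Q ** dg (\<chi> i. d $ i ^ k) ** ctranspose Q"
proof (induction k)
  case 0
  show ?case using assms by (simp add: mpower_def dg_one unitary_def)
next
  case (Suc k)
  have "mpower (Q ** dg d ** ctranspose Q) (Suc k)
    = Q ** dg d ** ctranspose Q ** (Q ** dg (\<chi> i. d $ i ^ k) ** ctranspose Q)"
    using Suc by (simp add: mpower_def)
  also have "\<dots> = Q ** dg d ** (ctranspose Q ** Q) ** dg (\<chi> i. d $ i ^ k) ** ctranspose Q"
    by (simp add: matrix_mul_assoc)
  also have "\<dots> = Q ** (dg d ** dg (\<chi> i. d $ i ^ k)) ** ctranspose Q"
    using assms by (simp add: unitary_def matrix_mul_assoc)
  finally show ?case by (simp add: dg_mult_dg)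
qed

lemma mexp_conj_dg:
  assumes "unitary Q"
  shows "mexp (Q ** dg d ** ctranspose Q) = Q ** dg (\<chi> i. exp (d $ i)) ** ctranspose Q"
proof -
  have "(\<lambda>k. \<chi> i. d $ i ^ k /\<^sub>R fact k) sums (\<chi> i. exp (d $ i))"
    unfolding sums_def
    by (rule vec_tendstoI) (use exp_converges in \<open>simp add: sums_def\<close>)
  from bounded_linear.sums[OF bounded_linear_conj_dg this, of Q "ctranspose Q"]
  have "(\<lambda>k. mpower (Q ** dg d ** ctranspose Q) k /\<^sub>R fact k) sums (Q ** dg (\<chi> i. exp (d $ i)) ** ctranspose Q)"
  proof (rule back_subst[of "\<lambda>f. f sums _"], intro ext)
    fix k
    have "(\<chi> i. d $ i ^ k /\<^sub>R fact k) = (\<chi> i. d $ i ^ k) /\<^sub>R fact k"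
      by (simp add: vec_eq_iff)
    then show "Q ** dg (\<chi> i. d $ i ^ k /\<^sub>R fact k) ** ctranspose Q
        = mpower (Q ** dg d ** ctranspose Q) k /\<^sub>R fact k"
      by (simp only: mpower_conj_dg[OF assms] dg_scaleR matrix_mult_scaleR_left matrix_mult_scaleR_right)
  qed
  then show ?thesis
    unfolding mexp_def by (rule sums_unique[symmetric])
qed

lemma mexp_hermitian:
  assumes "unitary Q" "Z = Q ** dg (\<chi> j. of_real (z j)) ** ctranspose Q"
  shows "mexp (cscale (\<i> * of_real t) Z) = Q ** dg (\<chi> j. cis (t * z j)) ** ctranspose Q"
proof -
  have "cscale (\<i> * of_real t) (dg (\<chi> j. of_real (z j))) = dg (\<chi> j. \<i> * of_real (t * z j))"
    by (simp add: vec_eq_iff cscale_def)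
  then have "cscale (\<i> * of_real t) Z = Q ** dg (\<chi> j. \<i> * of_real (t * z j)) ** ctranspose Q"
    unfolding assms(2) by (metis cscale_mult_left cscale_mult_right)
  then show ?thesis
    by (simp add: mexp_conj_dg[OF assms(1)] cis_conv_exp)
qed

lemma geodesic_derivative:
  "((\<lambda>t. U ** (Q ** dg (\<chi> j. cis (t * w j)) ** ctranspose Q)) has_vector_derivative
     U ** (Q ** dg (\<chi> j. \<i> * w j * cis (t * w j)) ** ctranspose Q)) (at t within S)"
  by (intro bounded_linear.has_vector_derivative[OF bounded_linear_matrix_mult_left]
      bounded_linear.has_vector_derivative[OF bounded_linear_conj_dg]
      has_vector_derivative_vec_lambda has_vector_derivative_cis)

lemma geodesic_unitary_curve:
  assumes b: "0 < b" and U: "unitary U" and Q: "unitary Q"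
  shows "unitary_curve b U (U ** (Q ** dg (\<chi> j. cis (b * w j)) ** ctranspose Q))
    (\<lambda>t. U ** (Q ** dg (\<chi> j. cis (t * w j)) ** ctranspose Q))"
proof -
  let ?\<gamma> = "\<lambda>t. U ** (Q ** dg (\<chi> j. cis (t * w j)) ** ctranspose Q)"
  let ?D = "\<lambda>t. U ** (Q ** dg (\<chi> j. \<i> * w j * cis (t * w j)) ** ctranspose Q)"
  have "continuous_on {0..b} ?D"
    by (intro bounded_linear.continuous_on[OF bounded_linear_matrix_mult_left]
        bounded_linear.continuous_on[OF bounded_linear_conj_dg] continuous_on_vec_lambda continuous_intros)
  then have "C1_on_interval ?\<gamma> 0 b"
    unfolding C1_on_interval_def using geodesic_derivative by blast
  moreover have "continuous_on {0..b} ?\<gamma>"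
    unfolding continuous_on_eq_continuous_within
    using geodesic_derivative has_vector_derivative_continuous by blast
  ultimately have "piecewise_C1 ?\<gamma> 0 b"
    unfolding piecewise_C1_def using b
    by (intro conjI exI[of _ "1::nat"] exI[of _ "\<lambda>i::nat. if i = 0 then 0 else b"]) auto
  moreover have "unitary (?\<gamma> t)" for t
    using U Q by (intro unitary_mult unitary_ctranspose unitary_dg) auto
  moreover have "?\<gamma> 0 = U"
    using Q by (simp add: dg_one unitary_def)
  ultimately show ?thesis by (simp add: unitary_curve_def)
qed

lemma geodesic_action:
  assumes L: "symmetric_lagrangian L" and b: "0 < b" and U: "unitary U" and Q: "unitary Q"
  shows "action L b (\<lambda>t. U ** (Q ** dg (\<chi> j. cis (t * w j)) ** ctranspose Q))
    = b * L (dg (\<chi> j. of_real (w j)))"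
proof -
  have "L (vector_derivative (\<lambda>t. U ** (Q ** dg (\<chi> j. cis (t * w j)) ** ctranspose Q)) (at t within {0..b}))
      = L (dg (\<chi> j. of_real (w j)))" if "t \<in> {0..b}" for t
  proof -
    have "vector_derivative (\<lambda>t. U ** (Q ** dg (\<chi> j. cis (t * w j)) ** ctranspose Q)) (at t within {0..b})
        = U ** (Q ** dg (\<chi> j. \<i> * w j * cis (t * w j)) ** ctranspose Q)"
      by (rule vector_derivative_within_cbox[of 0 b, unfolded cbox_interval])
        (use that b geodesic_derivative in auto)
    also have "L \<dots> = L (dg (\<chi> j. of_real (w j)))"
      unfolding lagrangian_unitary_left[OF L U] lagrangian_conj[OF L Q]
      by (rule lagrangian_dg_cong[OF L]) (simp add: norm_mult)
    finally show ?thesis .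
  qed
  then show ?thesis
    unfolding action_def using b by (subst integral_cong) auto
qed

section \<open>The case of equality\<close>

text \<open>A hyperplane separates the point \<open>(x, f x)\<close> from the strict epigraph.
  Strictness makes the two sets disjoint; the inequality at height \<open>f y\<close> itself is
  recovered from the heights \<open>f y + e\<close>.\<close>

lemma convex_subgradient:
  fixes f :: "'a::euclidean_space \<Rightarrow> real"
  assumes f: "convex_on UNIV f"
  obtains w where "\<And>y. f x + w \<bullet> (y - x) \<le> f y"
proof -
  define T where "T = {p :: 'a \<times> real. f (fst p) < snd p}"
  have "convex T"
    unfolding convex_def
  proof (intro ballI allI impI)
    fix p q :: "'a \<times> real" and u v :: real
    assume pq: "p \<in> T" "q \<in> T" and uv: "0 \<le> u" "0 \<le> v" "u + v = 1"
    have "f (u *\<^sub>R fst p + v *\<^sub>R fst q) \<le> u * f (fst p) + v * f (fst q)"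
      using f uv by (simp add: convex_on_def)
    also have "\<dots> < u * snd p + v * snd q"
    proof (cases "u = 0")
      case False
      then have "u * f (fst p) < u * snd p" using pq uv by (simp add: T_def)
      moreover have "v * f (fst q) \<le> v * snd q" using pq uv by (intro mult_left_mono) (auto simp: T_def)
      ultimately show ?thesis by simp
    qed (use pq uv in \<open>simp add: T_def\<close>)
    finally show "u *\<^sub>R p + v *\<^sub>R q \<in> T" by (simp add: T_def)
  qed
  moreover have "(x, f x + 1) \<in> T" "{(x, f x)} \<inter> T = {}" by (auto simp: T_def)
  ultimately have "\<exists>a b. a \<noteq> 0 \<and> (\<forall>p\<in>{(x, f x)}. inner a p \<le> b) \<and> (\<forall>p\<in>T. b \<le> inner a p)"
    by (intro separating_hyperplane_sets) auto
  then obtain a b where ab: "a \<noteq> 0" "inner a (x, f x) \<le> b" "\<And>p. p \<in> T \<Longrightarrow> b \<le> inner a p"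
    by blast
  obtain w \<tau> where a: "a = (w, \<tau>)" by (cases a)
  have sep: "w \<bullet> x + \<tau> * f x \<le> w \<bullet> y + \<tau> * s" if "f y < s" for y s
    using ab(2) ab(3)[of "(y, s)"] that by (simp add: T_def a)
  have "0 \<le> \<tau>"
    using sep[of x "f x + 1"] by (simp add: distrib_left)
  \<comment> \<open>The hyperplane is not vertical, because \<open>f\<close> is finite everywhere
    and the epigraph extends over points on both sides of \<open>x\<close>.\<close>
  moreover have "\<tau> \<noteq> 0"
  proof
    assume "\<tau> = 0"
    then have "w \<bullet> w \<le> 0"
      using sep[of "x - w" "f (x - w) + 1"] by (simp add: inner_diff_right)
    then have "w = 0" by (metis inner_gt_zero_iff not_less)
    then show False using ab(1) a \<open>\<tau> = 0\<close> by (simp add: zero_prod_def)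
  qed
  ultimately have \<tau>: "0 < \<tau>" by simp
  have "f x + (- (1 / \<tau>) *\<^sub>R w) \<bullet> (y - x) \<le> f y" for y
  proof (rule field_le_epsilon)
    fix e :: real assume "0 < e"
    then have "\<tau> * f x + w \<bullet> (x - y) \<le> \<tau> * (f y + e)"
      using sep[of y "f y + e"] by (simp add: inner_diff_right)
    then have "f x + w \<bullet> (x - y) / \<tau> \<le> f y + e"
      using \<tau> by (simp add: field_simps)
    then show "f x + (- (1 / \<tau>) *\<^sub>R w) \<bullet> (y - x) \<le> f y + e"
      using \<tau> by (simp add: inner_diff_right diff_divide_distrib)
  qed
  then show ?thesis using that by blast
qed

section \<open>Support functions of unitary orbits\<close>

lemma compact_unitary: "compact {U :: complex^'n^'n. unitary U}"
proof -
  have ct: "continuous_on UNIV (ctranspose :: complex^'n^'n \<Rightarrow> _)"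
    by (intro linear_continuous_on bounded_linear_ctranspose)
  have "closed {U :: complex^'n^'n. unitary U}"
    unfolding unitary_def
    by (intro closed_Collect_conj closed_Collect_eq continuous_on_const
        bounded_bilinear.continuous_on[OF bounded_bilinear_matrix_mult] ct continuous_on_id)
  moreover have "norm U = norm (mat 1 :: complex^'n^'n)" if "unitary U" for U :: "complex^'n^'n"
    using norm_unitary_mult[OF that, of "mat 1"] by simp
  then have "bounded {U :: complex^'n^'n. unitary U}"
    unfolding bounded_iff by (metis mem_Collect_eq order_refl)
  ultimately show ?thesis by (simp add: compact_eq_bounded_closed)
qed

text \<open>The support function of the two-sided unitary orbit of \<open>W\<close>. By von
  Neumann's trace inequality it is the sum of the products of the decreasingly ordered singular
  values of \<open>W\<close> and \<open>A\<close>.\<close>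

definition orbit_sup :: "complex^'n^'n \<Rightarrow> complex^'n^'n \<Rightarrow> real" where
  "orbit_sup W A = (SUP (U, V)\<in>{U. unitary U} \<times> {V. unitary V}. W \<bullet> (U ** A ** V))"

lemma orbit_inner_bounded:
  fixes W A :: "complex^'n^'n"
  shows "bdd_above ((\<lambda>(U, V). W \<bullet> (U ** A ** V)) ` ({U. unitary U} \<times> {V. unitary V}))"
proof (rule bdd_aboveI2)
  fix p assume "p \<in> {U :: complex^'n^'n. unitary U} \<times> {V :: complex^'n^'n. unitary V}"
  then show "(case p of (U, V) \<Rightarrow> W \<bullet> (U ** A ** V)) \<le> norm W * norm A"
    using norm_cauchy_schwarz[of W "fst p ** A ** snd p"]
    by (auto simp: norm_unitary_mult norm_mult_unitary)
qed

lemma orbit_sup_upper: "unitary U \<Longrightarrow> unitary V \<Longrightarrow> W \<bullet> (U ** A ** V) \<le> orbit_sup W A"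
  unfolding orbit_sup_def using cSUP_upper[OF _ orbit_inner_bounded, of "(U, V)" W A] by auto

lemma orbit_sup_least:
  assumes "\<And>U V. unitary U \<Longrightarrow> unitary V \<Longrightarrow> W \<bullet> (U ** A ** V) \<le> s"
  shows "orbit_sup W A \<le> s"
  unfolding orbit_sup_def using assms unitary_mat1 by (intro cSUP_least) auto

text \<open>A supremum of linear functions is convex, and translating the orbit only permutes them.
  Nonnegativity holds because \<open>- mat 1\<close> is unitary, so that both
  \<open>W \<bullet> A\<close> and its negative compete.\<close>

lemma orbit_sup_lagrangian:
  fixes W :: "complex^'n^'n"
  shows "symmetric_lagrangian (orbit_sup W)"
  unfolding symmetric_lagrangian_def
proof (intro conjI allI impI)
  fix A :: "complex^'n^'n"
  have "- mat 1 = dg (\<chi> i :: 'n. - 1)"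
    by (simp add: vec_eq_iff mat_def)
  then have "unitary (- mat 1 :: complex^'n^'n)"
    by (metis unitary_dg norm_minus_cancel norm_one vec_lambda_beta)
  then have "W \<bullet> (- mat 1 ** A ** mat 1) \<le> orbit_sup W A"
    by (rule orbit_sup_upper[OF _ unitary_mat1])
  moreover have "- mat 1 ** A = - A"
    using matrix_diff_rdistrib[of 0 "mat 1" A] by simp
  ultimately have "- (W \<bullet> A) \<le> orbit_sup W A" by simp
  moreover have "W \<bullet> A \<le> orbit_sup W A"
    using orbit_sup_upper[OF unitary_mat1 unitary_mat1, of W A] by simp
  ultimately show "0 \<le> orbit_sup W A" by linarith
next
  show "convex_on UNIV (orbit_sup W)"
  proof (rule convex_onI)
    fix t :: real and A B :: "complex^'n^'n"
    assume t: "0 < t" "t < 1"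
    show "orbit_sup W ((1 - t) *\<^sub>R A + t *\<^sub>R B) \<le> (1 - t) * orbit_sup W A + t * orbit_sup W B"
    proof (rule orbit_sup_least)
      fix U V :: "complex^'n^'n"
      assume UV: "unitary U" "unitary V"
      have "W \<bullet> (U ** ((1 - t) *\<^sub>R A + t *\<^sub>R B) ** V)
          = (1 - t) * (W \<bullet> (U ** A ** V)) + t * (W \<bullet> (U ** B ** V))"
        by (simp add: matrix_add_ldistrib matrix_add_rdistrib matrix_mult_scaleR_left
            matrix_mult_scaleR_right inner_add_right)
      also have "\<dots> \<le> (1 - t) * orbit_sup W A + t * orbit_sup W B"
        using t UV by (intro add_mono mult_left_mono orbit_sup_upper) auto
      finally show "W \<bullet> (U ** ((1 - t) *\<^sub>R A + t *\<^sub>R B) ** V) \<le> (1 - t) * orbit_sup W A + t * orbit_sup W B" .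
    qed
  qed simp
next
  have "orbit_sup W 0 \<le> 0" by (rule orbit_sup_least) simp
  moreover have "0 \<le> orbit_sup W 0"
    using orbit_sup_upper[OF unitary_mat1 unitary_mat1, of W 0] by simp
  ultimately show "orbit_sup W 0 = 0" by simp
next
  have le: "orbit_sup W (U ** A ** V) \<le> orbit_sup W A" if UV: "unitary U" "unitary V" for A U V :: "complex^'n^'n"
  proof (rule orbit_sup_least)
    fix U' V' :: "complex^'n^'n"
    assume "unitary U'" "unitary V'"
    then have "W \<bullet> ((U' ** U) ** A ** (V ** V')) \<le> orbit_sup W A"
      using UV by (intro orbit_sup_upper unitary_mult)
    then show "W \<bullet> (U' ** (U ** A ** V) ** V') \<le> orbit_sup W A"
      by (simp add: matrix_mul_assoc)
  qed
  fix A U V :: "complex^'n^'n"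
  assume UV: "unitary U" "unitary V"
  have "A = ctranspose U ** (U ** A ** V) ** ctranspose V"
    using UV by (simp add: unitary_cancel flip: matrix_mul_assoc) (simp add: unitary_def)
  then have "orbit_sup W A \<le> orbit_sup W (U ** A ** V)"
    using le[of "ctranspose U" "ctranspose V" "U ** A ** V"] UV by (simp add: unitary_ctranspose)
  with le[OF UV, of A] show "orbit_sup W (U ** A ** V) = orbit_sup W A" by simp
qed

lemma inner_dg: "dg (\<chi> j. of_real (w j)) \<bullet> A = (\<Sum>j\<in>UNIV. w j * Re (A $ j $ j))"
proof -
  have "(\<Sum>i\<in>UNIV. cnj (dg (\<chi> j. of_real (w j)) $ j $ i) * A $ j $ i) = of_real (w j) * A $ j $ j" for j
  proof -
    have "(\<Sum>i\<in>UNIV. cnj (dg (\<chi> j. of_real (w j)) $ j $ i) * A $ j $ i)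
      = (\<Sum>i\<in>UNIV. if i = j then of_real (w j) * A $ j $ j else 0)"
      by (intro sum.cong refl) auto
    then show ?thesis by simp
  qed
  then show ?thesis by (simp add: inner_matrix)
qed

text \<open>The orbit supremum of \<open>dg w\<close> below is a symmetric Lagrangian that, up to a constant, touches
  \<open>L\<close> from below at \<open>dg x\<close>; for strictly convex \<open>L\<close> only along the orbit of \<open>dg x\<close>.\<close>

lemma diagonal_subgradient:
  fixes L :: "complex^'n^'n \<Rightarrow> real"
  assumes L: "symmetric_lagrangian L" and x: "\<And>j. 0 \<le> x j" and X: "X = dg (\<chi> j. of_real (x j))"
  obtains w where "\<And>j. 0 \<le> w j" "\<And>A. L X + dg (\<chi> j. of_real (w j)) \<bullet> (A - X) \<le> L A"
proof -
  have "convex_on UNIV L" using L by (simp add: symmetric_lagrangian_def)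
  then obtain W0 where W0: "\<And>A. L X + W0 \<bullet> (A - X) \<le> L A"
    using convex_subgradient[of L X] by metis
  define w0 where "w0 j = Re (W0 $ j $ j)" for j
  define w where "w j = \<bar>w0 j\<bar>" for j
  have raw: "L X + (\<Sum>j\<in>UNIV. w j * Re (A $ j $ j)) - (\<Sum>j\<in>UNIV. w0 j * x j) \<le> L A" for A
  proof -
    \<comment> \<open>The raw subgradient is tested on real diagonal matrices only, so just its real
      diagonal \<open>w0\<close> matters. Choosing the sign of \<open>y j\<close> to match
      \<open>w0 j\<close> replaces \<open>w0 j\<close> by its absolute value, and \<open>L\<close>
      does not see the sign. At \<open>X\<close> the same replacement only increases the subtracted
      term, since \<open>x\<close> is nonnegative.\<close>
    define y where "y j = (if w0 j < 0 then - Re (A $ j $ j) else Re (A $ j $ j))" for j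
    have "W0 \<bullet> (dg (\<chi> j. of_real (y j)) - X) = dg (\<chi> j. of_real (y j - x j)) \<bullet> W0"
      unfolding X by (subst inner_commute) (rule arg_cong2[where f = inner], auto simp: vec_eq_iff)
    also have "\<dots> = (\<Sum>j\<in>UNIV. (y j - x j) * w0 j)"
      by (simp only: inner_dg w0_def)
    also have "\<dots> = (\<Sum>j\<in>UNIV. w j * Re (A $ j $ j)) - (\<Sum>j\<in>UNIV. w0 j * x j)"
      unfolding sum_subtractf[symmetric]
      by (intro sum.cong refl) (auto simp: y_def w_def algebra_simps)
    finally have "L X + (\<Sum>j\<in>UNIV. w j * Re (A $ j $ j)) - (\<Sum>j\<in>UNIV. w0 j * x j)
        \<le> L (dg (\<chi> j. of_real (y j)))"
      using W0[of "dg (\<chi> j. of_real (y j))"] by simp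
    also have "\<dots> \<le> L (dg (diag A))"
      by (rule lagrangian_dg_mono[OF L]) (auto simp: y_def abs_Re_le_cmod)
    also have "\<dots> \<le> L A" by (rule lagrangian_pinching[OF L])
    finally show ?thesis .
  qed
  have "(\<Sum>j\<in>UNIV. w0 j * x j) \<le> (\<Sum>j\<in>UNIV. w j * x j)"
    using x by (intro sum_mono mult_right_mono) (auto simp: w_def)
  then have "L X + dg (\<chi> j. of_real (w j)) \<bullet> (A - X) \<le> L A" for A
    using raw[of A] unfolding inner_diff_right inner_dg by (simp add: X)
  then show ?thesis using that[of w] by (simp add: w_def)
qed

text \<open>The subgradient inequality is applied along the whole orbit of \<open>A\<close>, on
  which \<open>L\<close> is constant; the supremum of its right-hand sides is the support
  function.\<close>

lemma touching_lagrangian: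
  fixes L :: "complex^'n^'n \<Rightarrow> real"
  assumes L: "symmetric_lagrangian L" and sub: "\<And>A. L X + W \<bullet> (A - X) \<le> L A"
  shows "orbit_sup W X = W \<bullet> X" "L X + orbit_sup W A - orbit_sup W X \<le> L A"
proof -
  have le: "orbit_sup W A \<le> L A - L X + W \<bullet> X" for A
  proof (rule orbit_sup_least)
    fix U V :: "complex^'n^'n"
    assume "unitary U" "unitary V"
    then show "W \<bullet> (U ** A ** V) \<le> L A - L X + W \<bullet> X"
      using sub[of "U ** A ** V"] lagrangian_unitary[OF L, of U V A] by (simp add: inner_diff_right)
  qed
  have "W \<bullet> X \<le> orbit_sup W X"
    using orbit_sup_upper[OF unitary_mat1 unitary_mat1, of W X] by simp
  then show "orbit_sup W X = W \<bullet> X" using le[of X] by simp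
  then show "L X + orbit_sup W A - orbit_sup W X \<le> L A" using le[of A] by simp
qed

text \<open>For nonnegative diagonal \<open>W\<close> and \<open>dg p\<close> the arithmetic-geometric mean inequality reduces the
  two-sided orbit to the conjugation orbit, which consists of Hermitian matrices.\<close>

lemma orbit_sup_attained:
  fixes w p :: "'n::finite \<Rightarrow> real"
  assumes w: "\<And>j. 0 \<le> w j" and p: "\<And>j. 0 \<le> p j"
  defines "W \<equiv> dg (\<chi> j. of_real (w j))" and "P \<equiv> dg (\<chi> j. of_real (p j))"
  obtains U where "unitary U" "orbit_sup W P \<le> W \<bullet> (U ** P ** ctranspose U)"
proof -
  have conj: "W \<bullet> (U ** P ** ctranspose U) = (\<Sum>j\<in>UNIV. \<Sum>k\<in>UNIV. w j * p k * (norm (U $ j $ k))\<^sup>2)" for U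
    unfolding W_def P_def inner_dg conj_dg_diag
    by (simp add: sum_distrib_left mult_ac del: of_real_power)
  have "continuous_on {U. unitary U} (\<lambda>U. W \<bullet> (U ** P ** ctranspose U))"
    unfolding conj by (intro continuous_intros)
  moreover have "{U :: complex^'n^'n. unitary U} \<noteq> {}" using unitary_mat1 by auto
  ultimately have "\<exists>U0\<in>{U. unitary U}. \<forall>U\<in>{U. unitary U}.
      W \<bullet> (U ** P ** ctranspose U) \<le> W \<bullet> (U0 ** P ** ctranspose U0)"
    by (intro continuous_attains_sup compact_unitary)
  then obtain U0 where U0: "unitary U0"
    and max: "\<And>U. unitary U \<Longrightarrow> W \<bullet> (U ** P ** ctranspose U) \<le> W \<bullet> (U0 ** P ** ctranspose U0)"
    by blast
  have "orbit_sup W P \<le> W \<bullet> (U0 ** P ** ctranspose U0)"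
  proof (rule orbit_sup_least)
    fix U V :: "complex^'n^'n"
    assume UV: "unitary U" "unitary V"
    have "W \<bullet> (U ** P ** V) = (\<Sum>j\<in>UNIV. \<Sum>k\<in>UNIV. w j * p k * Re (U $ j $ k * V $ k $ j))"
      unfolding W_def P_def inner_dg
      by (subst matrix_mult_nth) (simp add: sum_distrib_left algebra_simps)
    also have "\<dots> \<le> (\<Sum>j\<in>UNIV. \<Sum>k\<in>UNIV. w j * p k * (((norm (U $ j $ k))\<^sup>2 + (norm (ctranspose V $ j $ k))\<^sup>2) / 2))"
    proof (intro sum_mono mult_left_mono)
      fix j k
      have "Re (U $ j $ k * V $ k $ j) \<le> norm (U $ j $ k) * norm (V $ k $ j)"
        using complex_Re_le_cmod[of "U $ j $ k * V $ k $ j"] by (simp add: norm_mult)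
      then show "Re (U $ j $ k * V $ k $ j) \<le> ((norm (U $ j $ k))\<^sup>2 + (norm (ctranspose V $ j $ k))\<^sup>2) / 2"
        using sum_squares_bound[of "norm (U $ j $ k)" "norm (V $ k $ j)"] by simp
    qed (use w p in auto)
    also have "\<dots> = (W \<bullet> (U ** P ** ctranspose U) + W \<bullet> (ctranspose V ** P ** ctranspose (ctranspose V))) / 2"
      unfolding conj
      by (simp add: sum_divide_distrib algebra_simps add_divide_distrib sum.distrib)
    also have "\<dots> \<le> W \<bullet> (U0 ** P ** ctranspose U0)"
      using max[OF UV(1)] max[OF unitary_ctranspose[OF UV(2)]] by simp
    finally show "W \<bullet> (U ** P ** V) \<le> W \<bullet> (U0 ** P ** ctranspose U0)" .
  qed
  then show ?thesis using that U0 by blast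
qed

text \<open>Strict convexity speaks about Hermitian matrices, so \<open>P\<close> is first replaced
  by a conjugate \<open>Y\<close> at which the orbit supremum is attained. Then \<open>L\<close>
  meets its affine minorant at \<open>X\<close> and at \<open>Y\<close>, hence also at their
  midpoint, and strictness gives \<open>Y = X\<close>. Conjugation preserves the Frobenius
  norm.\<close>

lemma touching_norm:
  fixes L :: "complex^'n^'n \<Rightarrow> real"
  assumes L: "symmetric_lagrangian L" and strict: "strictly_convex_lagrangian L"
    and X: "X = dg (\<chi> j. of_real (x j))"
    and w: "\<And>j. 0 \<le> w j" and W: "W = dg (\<chi> j. of_real (w j))"
    and sub: "\<And>A. L X + W \<bullet> (A - X) \<le> L A"
    and p: "\<And>j. 0 \<le> p j" and P: "P = dg (\<chi> j. of_real (p j))"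
    and eq: "L P \<le> L X + orbit_sup W P - orbit_sup W X"
  shows "norm P = norm X"
proof -
  obtain U where U: "unitary U" "orbit_sup W P \<le> W \<bullet> (U ** P ** ctranspose U)"
    unfolding W P by (rule orbit_sup_attained[of w p, OF w p])
  define Y where "Y = U ** P ** ctranspose U"
  have "hermitian Y" "hermitian X"
    by (simp_all add: hermitian_def Y_def P X ctranspose_mult matrix_mul_assoc ctranspose_dg)
  have LY: "L Y = L P" unfolding Y_def by (rule lagrangian_conj[OF L U(1)])
  have "L Y \<le> L X + W \<bullet> (Y - X)"
    using eq U(2)[folded Y_def] touching_lagrangian(1)[OF L sub] by (simp add: LY inner_diff_right)
  moreover have "L X + W \<bullet> ((1/2) *\<^sub>R Y + (1 - 1/2) *\<^sub>R X - X) \<le> L ((1/2) *\<^sub>R Y + (1 - 1/2) *\<^sub>R X)"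
    by (rule sub)
  moreover have "W \<bullet> ((1/2) *\<^sub>R Y + (1 - 1/2) *\<^sub>R X - X) = W \<bullet> (Y - X) / 2"
    by (simp add: inner_diff_right inner_add_right)
  moreover have "L ((1/2) *\<^sub>R Y + (1 - 1/2) *\<^sub>R X) \<le> 1/2 * L Y + (1 - 1/2) * L X"
    by (rule lagrangian_convex[OF L]) auto
  moreover have "k = 1/2 * a + (1 - 1/2) * b"
    if "a \<le> b + e" "b + f \<le> k" "f = e / 2" "k \<le> 1/2 * a + (1 - 1/2) * b" for a b e f k :: real
    using that by simp
  ultimately have "L ((1/2) *\<^sub>R Y + (1 - 1/2) *\<^sub>R X) = 1/2 * L Y + (1 - 1/2) * L X"
    by blast
  then have "\<exists>u::real. 0 < u \<and> u < 1 \<and> L (u *\<^sub>R Y + (1 - u) *\<^sub>R X) = u * L Y + (1 - u) * L X"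
    by (intro exI[of _ "1/2"]) simp
  then have "Y = X"
    using strict \<open>hermitian Y\<close> \<open>hermitian X\<close> unfolding strictly_convex_lagrangian_def by blast
  moreover have "norm Y = norm P"
    using U by (simp add: Y_def norm_unitary_mult norm_mult_unitary unitary_ctranspose)
  ultimately show ?thesis by simp
qed

text \<open>Differentiating \<open>ctranspose (W t) ** W t = mat 1\<close> shows that
  \<open>ctranspose (W t) ** A\<close> is \<open>\<i>\<close> times a Hermitian matrix. The same
  \<open>p\<close>, the moduli of its eigenvalues, serves every Lagrangian at once, as the
  comparison of two of them requires.\<close>

lemma unitary_velocity:
  fixes W D :: "real \<Rightarrow> complex^'n^'n"
  assumes cd: "c < d" and t: "t \<in> {c..d}"
    and W: "\<And>t. t \<in> {c..d} \<Longrightarrow> unitary (W t)"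
    and deriv: "(W has_vector_derivative A) (at t within {c..d})"
  obtains p where "\<And>j. 0 \<le> p j" "norm A = norm (dg (\<chi> j. complex_of_real (p j)))"
    "\<And>L. symmetric_lagrangian L \<Longrightarrow> L A = L (dg (\<chi> j. complex_of_real (p j)))"
proof -
  have "((\<lambda>t. ctranspose (W t) ** W t) has_vector_derivative
      ctranspose (W t) ** A + ctranspose A ** W t) (at t within {c..d})"
    by (intro bounded_bilinear.has_vector_derivative[OF bounded_bilinear_matrix_mult] deriv
        bounded_linear.has_vector_derivative[OF bounded_linear_ctranspose])
  moreover have "((\<lambda>t. ctranspose (W t) ** W t) has_vector_derivative 0) (at t within {c..d})"
    by (rule has_vector_derivative_transform[OF t, of _ "\<lambda>_. mat 1"])
      (use W in \<open>auto simp: unitary_def\<close>)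
  ultimately have skew: "ctranspose (W t) ** A + ctranspose A ** W t = 0"
    using vector_derivative_unique_within_closed_interval[of c d t] cd t by (auto simp: cbox_interval)
  define H where "H = cscale (- \<i>) (ctranspose (W t) ** A)"
  have "ctranspose H = cscale \<i> (ctranspose A ** W t)"
    by (simp add: H_def vec_eq_iff cscale_def matrix_mult_nth mult.commute)
  also have "ctranspose A ** W t = - (ctranspose (W t) ** A)"
    using skew by (simp add: eq_neg_iff_add_eq_0 add.commute)
  finally have "hermitian H"
    by (simp add: hermitian_def H_def vec_eq_iff cscale_def)
  then obtain Q h where Q: "unitary Q" "\<And>i. h $ i \<in> \<real>" "H = Q ** dg h ** ctranspose Q"
    by (rule hermitian_diagonalization) (rule that, assumption, blast, assumption)
  have "ctranspose (W t) ** A = cscale \<i> H"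
    by (simp add: H_def vec_eq_iff cscale_def)
  also have "\<dots> = Q ** dg (\<chi> j. \<i> * h $ j) ** ctranspose Q"
  proof -
    have "cscale \<i> (dg h) = dg (\<chi> j. \<i> * h $ j)" by (simp add: vec_eq_iff cscale_def)
    then show ?thesis unfolding Q(3) by (metis cscale_mult_left cscale_mult_right)
  qed
  finally have A: "A = W t ** (Q ** dg (\<chi> j. \<i> * h $ j) ** ctranspose Q)"
    by (metis W[OF t] unitary_cancel(2))
  show ?thesis
  proof (rule that[of "\<lambda>j. norm (h $ j)"])
    show "norm A = norm (dg (\<chi> j. complex_of_real (norm (h $ j))))"
      using W[OF t] Q(1) unfolding A
      by (simp add: norm_unitary_mult norm_mult_unitary unitary_ctranspose norm_dg)
        (simp add: norm_vec_def norm_mult)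
    show "L A = L (dg (\<chi> j. complex_of_real (norm (h $ j))))" if L: "symmetric_lagrangian L" for L
      unfolding A lagrangian_unitary_left[OF L W[OF t]] lagrangian_conj[OF L Q(1)]
      by (rule lagrangian_dg_cong[OF L]) (simp add: norm_mult)
  qed simp
qed

section \<open>Curves on the sphere\<close>

text \<open>Since \<open>c'\<close> is tangent to the sphere, only the part of \<open>u\<close>
  orthogonal to \<open>c\<close> matters; it has length \<open>sqrt (1 - y^2)\<close>, and
  \<open>\<kappa>^2 * (1 - y^2)\<close> is at most \<open>1 - \<kappa>^2 * y^2\<close>.\<close>

lemma sphere_angle_speed:
  fixes u c c' :: "'a::real_inner"
  assumes "norm u = 1" "norm c = 1" "c \<bullet> c' = 0" "0 \<le> \<kappa>" "\<kappa> < 1"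
  shows "\<bar>\<kappa> * (u \<bullet> c') / sqrt (1 - (\<kappa> * (u \<bullet> c))\<^sup>2)\<bar> \<le> norm c'"
proof -
  define y where "y = u \<bullet> c"
  have y: "\<bar>y\<bar> \<le> 1"
    using Cauchy_Schwarz_ineq2[of u c] assms by (simp add: y_def)
  then have y2: "y\<^sup>2 \<le> 1" by (simp add: abs_square_le_1)
  have "\<kappa>\<^sup>2 < 1" using assms by (simp add: abs_square_less_1)
  then have "\<kappa>\<^sup>2 * y\<^sup>2 \<le> \<kappa>\<^sup>2 * 1"
    using y2 by (intro mult_left_mono) auto
  then have pos: "0 < 1 - (\<kappa> * y)\<^sup>2"
    using \<open>\<kappa>\<^sup>2 < 1\<close> by (simp add: power_mult_distrib)
  have "(norm (u - y *\<^sub>R c))\<^sup>2 = (u - y *\<^sub>R c) \<bullet> (u - y *\<^sub>R c)"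
    by (rule power2_norm_eq_inner)
  also have "\<dots> = 1 - y\<^sup>2"
    using assms(1,2) by (simp add: inner_diff_left inner_diff_right norm_eq_1
        inner_commute[of c u] y_def[symmetric] power2_eq_square)
  finally have "(norm (u - y *\<^sub>R c))\<^sup>2 = 1 - y\<^sup>2" .
  moreover have "u \<bullet> c' = (u - y *\<^sub>R c) \<bullet> c'"
    using assms(3) by (simp add: inner_diff_left)
  ultimately have "\<bar>u \<bullet> c'\<bar> \<le> sqrt (1 - y\<^sup>2) * norm c'"
    using Cauchy_Schwarz_ineq2[of "u - y *\<^sub>R c" c'] by (metis norm_ge_zero real_sqrt_unique)
  then have "\<kappa> * \<bar>u \<bullet> c'\<bar> \<le> \<kappa> * (sqrt (1 - y\<^sup>2) * norm c')"
    using assms by (intro mult_left_mono) auto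
  also have "\<dots> = sqrt (\<kappa>\<^sup>2 * (1 - y\<^sup>2)) * norm c'"
    using assms by (simp add: real_sqrt_mult)
  also have "\<dots> \<le> sqrt (1 - (\<kappa> * y)\<^sup>2) * norm c'"
    using \<open>\<kappa>\<^sup>2 < 1\<close> by (intro mult_right_mono) (auto simp: power_mult_distrib algebra_simps)
  finally show ?thesis
    using pos assms unfolding y_def[symmetric]
    by (simp add: abs_mult divide_le_eq mult.commute)
qed

text \<open>The factor \<open>\<kappa> < 1\<close> keeps the argument of \<open>arccos\<close> away from \<open>\<plusminus>1\<close>, where it is not
  differentiable; it is removed by letting \<open>\<kappa> \<rightarrow> 1\<close>.\<close>

lemma sphere_angle_energy:
  fixes c c' :: "real \<Rightarrow> 'a::real_inner"
  assumes st: "s \<le> t" and cont: "continuous_on {s..t} c" and S: "finite S"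
    and deriv: "\<And>x. x \<in> {s<..<t} - S \<Longrightarrow> (c has_vector_derivative c' x) (at x)"
    and c1: "\<And>x. x \<in> {s..t} \<Longrightarrow> norm (c x) = 1" and u: "norm u = 1"
    and int: "(\<lambda>x. (norm (c' x))\<^sup>2) integrable_on {s..t}"
  shows "(arccos (u \<bullet> c t) - arccos (u \<bullet> c s))\<^sup>2 \<le> (t - s) * integral {s..t} (\<lambda>x. (norm (c' x))\<^sup>2)"
proof -
  let ?E = "integral {s..t} (\<lambda>x. (norm (c' x))\<^sup>2)"
  have y: "\<bar>u \<bullet> c x\<bar> \<le> 1" if "x \<in> {s..t}" for x
    using Cauchy_Schwarz_ineq2[of u "c x"] c1[OF that] u by simp
  have orth: "c x \<bullet> c' x = 0" if "x \<in> {s<..<t} - S" for x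
  proof -
    have "((\<lambda>x. c x \<bullet> c x) has_vector_derivative c x \<bullet> c' x + c' x \<bullet> c x) (at x)"
      by (rule bounded_bilinear.has_vector_derivative[OF bounded_bilinear_inner deriv[OF that] deriv[OF that]])
    moreover have "((\<lambda>x. c x \<bullet> c x) has_vector_derivative 0) (at x)"
    proof (rule has_vector_derivative_transform_within_open[of "\<lambda>_. 1" _ _ "{s<..<t}"])
      show "1 = c y \<bullet> c y" if "y \<in> {s<..<t}" for y
        using c1[of y] that by (simp add: norm_eq_1)
    qed (use that in auto)
    ultimately have "c x \<bullet> c' x + c' x \<bullet> c x = 0"
      by (rule vector_derivative_unique_at)
    then show ?thesis by (simp add: inner_commute)
  qed
  \<comment> \<open>Linearized Cauchy-Schwarz: integrating
    \<open>2 * k * \<phi>' <= k^2 + \<phi>'^2\<close> needs no square integrability of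
    \<open>\<phi>'\<close>. The parameter \<open>k\<close> is finally set to the mean angular speed,
    which is optimal.\<close>
  have key: "2 * k * (arccos (\<kappa> * (u \<bullet> c t)) - arccos (\<kappa> * (u \<bullet> c s))) \<le> k\<^sup>2 * (t - s) + ?E"
    if \<kappa>: "0 \<le> \<kappa>" "\<kappa> < 1" for k \<kappa>
  proof -
    have in1: "\<bar>\<kappa> * (u \<bullet> c x)\<bar> < 1" if "x \<in> {s..t}" for x
      using y[OF that] \<kappa> by (simp add: abs_mult) (smt (verit) mult_left_le)
    define \<phi>' where "\<phi>' x = (if x \<in> {s<..<t} - S
      then - (\<kappa> * (u \<bullet> c' x) / sqrt (1 - (\<kappa> * (u \<bullet> c x))\<^sup>2)) else 0)" for x
    have "(\<phi>' has_integral (arccos (\<kappa> * (u \<bullet> c t)) - arccos (\<kappa> * (u \<bullet> c s)))) {s..t}"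
    proof (rule fundamental_theorem_of_calculus_interior_strong[OF S st])
      fix x assume x: "x \<in> {s<..<t} - S"
      have "((\<lambda>x. \<kappa> * (u \<bullet> c x)) has_vector_derivative \<kappa> * (u \<bullet> c' x)) (at x)"
        by (intro bounded_linear.has_vector_derivative[OF bounded_linear_mult_right]
            bounded_linear.has_vector_derivative[OF bounded_linear_inner_right] deriv[OF x])
      then have "((\<lambda>x. \<kappa> * (u \<bullet> c x)) has_real_derivative \<kappa> * (u \<bullet> c' x)) (at x)"
        by (simp add: has_real_derivative_iff_has_vector_derivative)
      moreover have "- 1 < \<kappa> * (u \<bullet> c x)" "\<kappa> * (u \<bullet> c x) < 1"
        using in1[of x] x by auto
      ultimately have "((\<lambda>x. arccos (\<kappa> * (u \<bullet> c x))) has_real_derivative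
          inverse (- sqrt (1 - (\<kappa> * (u \<bullet> c x))\<^sup>2)) * (\<kappa> * (u \<bullet> c' x))) (at x)"
        by (intro DERIV_chain2[OF DERIV_arccos])
      also have "inverse (- sqrt (1 - (\<kappa> * (u \<bullet> c x))\<^sup>2)) * (\<kappa> * (u \<bullet> c' x)) = \<phi>' x"
        using x by (simp add: \<phi>'_def divide_inverse)
      finally have "((\<lambda>x. arccos (\<kappa> * (u \<bullet> c x))) has_real_derivative \<phi>' x) (at x)" .
      then show "((\<lambda>x. arccos (\<kappa> * (u \<bullet> c x))) has_vector_derivative \<phi>' x) (at x)"
        by (simp add: has_real_derivative_iff_has_vector_derivative)
    next
      show "continuous_on {s..t} (\<lambda>x. arccos (\<kappa> * (u \<bullet> c x)))"
        using in1 by (intro continuous_intros cont) (auto simp: abs_less_iff less_imp_le)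
    qed
    then have "((\<lambda>x. 2 * k * \<phi>' x) has_integral
        2 * k * (arccos (\<kappa> * (u \<bullet> c t)) - arccos (\<kappa> * (u \<bullet> c s)))) {s..t}"
      by (rule has_integral_mult_right)
    moreover have "((\<lambda>x. k\<^sup>2 + (norm (c' x))\<^sup>2) has_integral k\<^sup>2 * (t - s) + ?E) {s..t}"
      using has_integral_add[OF has_integral_const_real[of "k\<^sup>2" s t] integrable_integral[OF int]] st
      by (simp add: mult.commute)
    ultimately show ?thesis
    proof (rule has_integral_le)
      fix x assume x: "x \<in> {s..t}"
      have "\<bar>\<phi>' x\<bar> \<le> norm (c' x)"
      proof (cases "x \<in> {s<..<t} - S")
        case True
        then show ?thesis
          using sphere_angle_speed[OF u c1[OF x] orth[OF True] \<kappa>] by (simp add: \<phi>'_def)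
      qed (auto simp: \<phi>'_def)
      then have "\<bar>k\<bar> * \<bar>\<phi>' x\<bar> \<le> \<bar>k\<bar> * norm (c' x)"
        by (intro mult_left_mono) auto
      moreover have "k * \<phi>' x \<le> \<bar>k\<bar> * \<bar>\<phi>' x\<bar>"
        by (metis abs_ge_self abs_mult)
      moreover have "2 * (\<bar>k\<bar> * norm (c' x)) \<le> k\<^sup>2 + (norm (c' x))\<^sup>2"
        using sum_squares_bound[of "\<bar>k\<bar>" "norm (c' x)"] by simp
      ultimately show "2 * k * \<phi>' x \<le> k\<^sup>2 + (norm (c' x))\<^sup>2" by linarith
    qed
  qed
  have lim: "2 * k * (arccos (u \<bullet> c t) - arccos (u \<bullet> c s)) \<le> k\<^sup>2 * (t - s) + ?E" for k
  proof -
    define \<kappa> where "\<kappa> n = 1 - 1 / real (Suc n)" for n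
    have \<kappa>: "0 \<le> \<kappa> n" "\<kappa> n < 1" for n by (auto simp: \<kappa>_def field_simps)
    have "(\<lambda>n. 1 - 1 / real (Suc n)) \<longlonglongrightarrow> 1 - 0"
      by (intro tendsto_intros LIMSEQ_Suc[OF lim_1_over_n])
    then have lim1: "\<kappa> \<longlonglongrightarrow> 1" by (simp add: \<kappa>_def[abs_def])
    have "(\<lambda>n. arccos (\<kappa> n * (u \<bullet> c x))) \<longlonglongrightarrow> arccos (u \<bullet> c x)" if "x \<in> {s..t}" for x
    proof (rule continuous_on_tendsto_compose[OF continuous_on_arccos'])
      show "(\<lambda>n. \<kappa> n * (u \<bullet> c x)) \<longlonglongrightarrow> u \<bullet> c x"
        using tendsto_mult[OF lim1 tendsto_const[of "u \<bullet> c x"]] by simp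
      show "u \<bullet> c x \<in> {- 1..1}" using y[OF that] by auto
      have "\<bar>\<kappa> n * (u \<bullet> c x)\<bar> \<le> 1" for n
        using y[OF that] \<kappa>[of n] by (simp add: abs_mult mult_le_one)
      then show "\<forall>\<^sub>F n in sequentially. \<kappa> n * (u \<bullet> c x) \<in> {- 1..1}"
        by (intro always_eventually allI) (metis abs_le_iff atLeastAtMost_iff minus_le_iff)
    qed
    then have "(\<lambda>n. 2 * k * (arccos (\<kappa> n * (u \<bullet> c t)) - arccos (\<kappa> n * (u \<bullet> c s))))
        \<longlonglongrightarrow> 2 * k * (arccos (u \<bullet> c t) - arccos (u \<bullet> c s))"
      using st by (intro tendsto_intros) auto
    then show ?thesis
      by (rule LIMSEQ_le_const2) (use key[OF \<kappa>] in blast)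
  qed
  show ?thesis
  proof (cases "s = t")
    case False
    define T where "T = t - s"
    have T: "0 < T" using False st by (simp add: T_def)
    define \<Delta> where "\<Delta> = arccos (u \<bullet> c t) - arccos (u \<bullet> c s)"
    have "2 * (\<Delta> / T) * \<Delta> \<le> (\<Delta> / T)\<^sup>2 * T + ?E"
      using lim[of "\<Delta> / T"] by (simp add: \<Delta>_def T_def)
    moreover have "2 * (\<Delta> / T) * \<Delta> = 2 * (\<Delta>\<^sup>2 / T)" "(\<Delta> / T)\<^sup>2 * T = \<Delta>\<^sup>2 / T"
      using T by (simp_all add: power2_eq_square)
    ultimately have "\<Delta>\<^sup>2 / T \<le> ?E" by linarith
    then show ?thesis
      using T unfolding \<Delta>_def[symmetric] T_def[symmetric] by (simp add: divide_le_eq mult.commute)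
  qed simp
qed

text \<open>The last summand is the exact excess in Cauchy-Schwarz; it vanishes only if
  \<open>x\<close> is the share of \<open>x + y\<close> proportional to time.\<close>

lemma quotient_sum_squares:
  fixes x y t b :: real
  assumes "0 < t" "t < b"
  shows "x\<^sup>2 / t + y\<^sup>2 / (b - t) = (x + y)\<^sup>2 / b + (x - (x + y) * t / b)\<^sup>2 * b / (t * (b - t))"
  using assms by (simp add: divide_simps) (simp add: power2_eq_square algebra_simps)

text \<open>Each curve needs the energy \<open>(\<sigma> j)^2 / b\<close> plus a penalty for an
  angle at time \<open>t\<close> off the linear interpolation. Only the total energy is bounded, but
  the penalties are nonnegative, so a total of at most 0 makes each of them vanish.\<close>

lemma sphere_angles_rigid:
  fixes c c' :: "'i::finite \<Rightarrow> real \<Rightarrow> 'a::real_inner"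
  assumes t: "0 < t" "t < b" and cont: "\<And>j. continuous_on {0..b} (c j)" and S: "finite S"
    and deriv: "\<And>j x. x \<in> {0<..<b} - S \<Longrightarrow> (c j has_vector_derivative c' j x) (at x)"
    and c1: "\<And>j x. x \<in> {0..b} \<Longrightarrow> norm (c j x) = 1" and u: "\<And>j. norm (u j) = 1"
    and int: "\<And>j. (\<lambda>x. (norm (c' j x))\<^sup>2) integrable_on {0..b}"
    and \<sigma>: "\<And>j. \<sigma> j = arccos (u j \<bullet> c j b) - arccos (u j \<bullet> c j 0)"
    and energy: "(\<Sum>j\<in>UNIV. integral {0..b} (\<lambda>x. (norm (c' j x))\<^sup>2)) \<le> (\<Sum>j\<in>UNIV. (\<sigma> j)\<^sup>2 / b)"
  shows "arccos (u j \<bullet> c j t) = arccos (u j \<bullet> c j 0) + \<sigma> j * t / b"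
proof -
  define \<phi> where "\<phi> j x = arccos (u j \<bullet> c j x)" for j x
  define E where "E j = integral {0..b} (\<lambda>x. (norm (c' j x))\<^sup>2)" for j
  define X where "X j = \<phi> j t - \<phi> j 0" for j
  have \<sigma>': "\<sigma> j = X j + (\<phi> j b - \<phi> j t)" for j
    by (simp add: \<sigma> X_def \<phi>_def)
  have lower: "(\<sigma> j)\<^sup>2 / b + (X j - \<sigma> j * t / b)\<^sup>2 * b / (t * (b - t)) \<le> E j" for j
  proof -
    have i1: "(\<lambda>x. (norm (c' j x))\<^sup>2) integrable_on {0..t}"
      and i2: "(\<lambda>x. (norm (c' j x))\<^sup>2) integrable_on {t..b}"
      using t by (auto intro: integrable_subinterval_real[OF int])
    have "(X j)\<^sup>2 \<le> (t - 0) * integral {0..t} (\<lambda>x. (norm (c' j x))\<^sup>2)"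
      unfolding X_def \<phi>_def using t
      by (intro sphere_angle_energy[OF _ _ S deriv c1 u i1] continuous_on_subset[OF cont]) auto
    moreover have "(\<phi> j b - \<phi> j t)\<^sup>2 \<le> (b - t) * integral {t..b} (\<lambda>x. (norm (c' j x))\<^sup>2)"
      unfolding X_def \<phi>_def using t
      by (intro sphere_angle_energy[OF _ _ S deriv c1 u i2] continuous_on_subset[OF cont]) auto
    ultimately have "(X j)\<^sup>2 / t \<le> integral {0..t} (\<lambda>x. (norm (c' j x))\<^sup>2)"
      "(\<phi> j b - \<phi> j t)\<^sup>2 / (b - t) \<le> integral {t..b} (\<lambda>x. (norm (c' j x))\<^sup>2)"
      using t by (simp_all add: divide_le_eq mult.commute)
    moreover have "integral {0..t} (\<lambda>x. (norm (c' j x))\<^sup>2) + integral {t..b} (\<lambda>x. (norm (c' j x))\<^sup>2) = E j"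
      unfolding E_def using t by (intro Henstock_Kurzweil_Integration.integral_combine int) auto
    ultimately show ?thesis
      using quotient_sum_squares[OF t, of "X j" "\<phi> j b - \<phi> j t"] unfolding \<sigma>'[symmetric] by linarith
  qed
  define G where "G j = (X j - \<sigma> j * t / b)\<^sup>2 * b / (t * (b - t))" for j
  have G: "0 \<le> G j" for j using t by (simp add: G_def)
  have "(\<Sum>j\<in>UNIV. (\<sigma> j)\<^sup>2 / b + G j) \<le> (\<Sum>j\<in>UNIV. E j)"
    using lower by (intro sum_mono) (simp add: G_def)
  then have "sum G UNIV \<le> 0"
    using energy by (simp add: sum.distrib E_def)
  then have "G j = 0"
    using G by (metis UNIV_I antisym finite sum_nonneg sum_nonneg_eq_0_iff)
  then have "X j = \<sigma> j * t / b"
    using t by (simp add: G_def)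
  then show ?thesis by (simp add: X_def \<phi>_def)
qed

text \<open>The real inner product with \<open>u\<close> gives only the cosine and not the direction
  of departure. The inner product with the end point \<open>cis z *s u\<close> adds the component
  along \<open>\<i> *s u\<close>, as \<open>sin z\<close> is nonzero for \<open>z\<close> nonzero;
  for \<open>z = 0\<close> both points coincide, hence the separate hypothesis. Then
  \<open>cis \<theta> *s u\<close> and \<open>c\<close> are unit vectors with inner product
  1.\<close>

lemma great_circle_unique:
  fixes u c :: "complex^'n"
  assumes "norm u = 1" "norm c = 1" "\<bar>z\<bar> < pi"
    and 1: "u \<bullet> c = cos \<theta>" and 2: "(cis z *s u) \<bullet> c = cos (z - \<theta>)" and z0: "z = 0 \<Longrightarrow> \<theta> = 0"
  shows "c = cis \<theta> *s u"
proof -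
  define w where "w = (\<i> *s u) \<bullet> c"
  have expand: "(cis x *s u) \<bullet> c = cos x * (u \<bullet> c) + sin x * w" for x
    unfolding w_def inner_vec_def
    by (simp add: inner_complex_def sum_distrib_left flip: sum.distrib) (simp add: algebra_simps)
  have sw: "sin \<theta> * w = (sin \<theta>)\<^sup>2"
  proof (cases "z = 0")
    case False
    then have "sin z \<noteq> 0"
      using assms(3) sin_gt_zero[of z] sin_gt_zero[of "- z"] by (cases "z > 0") auto
    moreover have "sin z * w = sin z * sin \<theta>"
      using 2 by (simp add: expand 1 cos_diff)
    ultimately show ?thesis by (simp add: power2_eq_square)
  qed (simp add: z0)
  have "(cis \<theta> *s u) \<bullet> c = (cos \<theta>)\<^sup>2 + (sin \<theta>)\<^sup>2"
    unfolding expand 1 sw by (simp only: power2_eq_square)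
  then have inner: "(cis \<theta> *s u) \<bullet> c = 1" by simp
  have "norm (cis \<theta> *s u) = norm u"
    by (simp add: norm_vec_def norm_mult)
  then have "(cis \<theta> *s u) \<bullet> (cis \<theta> *s u) = 1" "c \<bullet> c = 1"
    using assms(1,2) by (simp_all add: norm_eq_1)
  then have "(cis \<theta> *s u - c) \<bullet> (cis \<theta> *s u - c) = 0"
    using inner by (simp add: inner_diff_left inner_diff_right inner_commute)
  then show ?thesis by simp
qed

section \<open>Uniqueness of the minimizer\<close>

text \<open>The excess \<open>f\<close> of \<open>L\<close> over the touching Lagrangian is
  nonnegative, and its integral along \<open>\<beta>\<close> is at most 0: the integral of
  \<open>L\<close> is at most its geodesic value by assumption, and that of \<open>N\<close> at
  least its own by \<open>action_lower_bound\<close>. By continuity \<open>f\<close> vanishes at all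
  velocities of each piece, where \<open>touching_norm\<close> applies.\<close>

lemma minimizer_energy:
  fixes L :: "complex^'n^'n \<Rightarrow> real"
  assumes L: "symmetric_lagrangian L" and strict: "strictly_convex_lagrangian L" and b: "0 < b"
    and \<beta>: "unitary_curve b U V \<beta>" and U: "unitary U" and Q: "unitary Q"
    and V: "V = U ** (Q ** dg (\<chi> j. cis (z j)) ** ctranspose Q)"
    and m: "0 \<le> m" "m < pi" and z: "\<And>j. \<bar>z j\<bar> \<le> m"
    and min: "action L b \<beta> \<le> b * L (dg (\<chi> j. of_real (z j)) /\<^sub>R b)"
  shows "((\<lambda>t. (norm (vector_derivative \<beta> (at t within {0..b})))\<^sup>2) has_integral
    (\<Sum>j\<in>UNIV. (z j)\<^sup>2 / b)) {0..b}"
proof -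
  define v where "v t = vector_derivative \<beta> (at t within {0..b})" for t
  \<comment> \<open>Absolute values provide the nonnegative entries that
    \<open>diagonal_subgradient\<close> asks for; no Lagrangian distinguishes \<open>X\<close> from
    the diagonal matrix of the \<open>z j / b\<close>.\<close>
  define x where "x j = \<bar>z j\<bar> / b" for j
  define X where "X = dg (\<chi> j. complex_of_real (x j))"
  have x: "0 \<le> x j" for j using b by (simp add: x_def)
  have LX: "N (dg (\<chi> j. of_real (z j)) /\<^sub>R b) = N X" if "symmetric_lagrangian N" for N
    unfolding X_def dg_scaleR[symmetric]
    using b by (intro lagrangian_dg_cong[OF that]) (simp add: x_def norm_inverse norm_mult divide_inverse mult.commute)
  obtain w where w: "\<And>j. 0 \<le> w j"
    and sub: "\<And>A. L X + dg (\<chi> j. of_real (w j)) \<bullet> (A - X) \<le> L A"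
    using diagonal_subgradient[OF L x X_def] by blast
  define W where "W = dg (\<chi> j. complex_of_real (w j))"
  define N where "N = orbit_sup W"
  have N: "symmetric_lagrangian N" unfolding N_def by (rule orbit_sup_lagrangian)
  note sub' = sub[folded W_def]
  define f where "f A = L A - L X - N A + N X" for A
  have f_nonneg: "0 \<le> f A" for A
    using touching_lagrangian(2)[OF L sub', of A] by (simp add: f_def N_def)
  have f_cont: "continuous_on UNIV f"
    unfolding f_def by (intro continuous_intros lagrangian_continuous L N)
  have pw: "piecewise_C1 \<beta> 0 b" and un: "\<And>t. t \<in> {0..b} \<Longrightarrow> unitary (\<beta> t)"
    using \<beta> by (auto simp: unitary_curve_def)
  have intF: "(\<lambda>t. F (v t)) integrable_on {0..b}" if "continuous_on UNIV F" for F :: "complex^'n^'n \<Rightarrow> real"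
    unfolding v_def by (rule speed_integrable[OF pw that])
  have total: "integral {0..b} (\<lambda>t. f (v t)) \<le> 0"
  proof -
    have iL: "((\<lambda>t. L (v t)) has_integral action L b \<beta>) {0..b}"
      and iN: "((\<lambda>t. N (v t)) has_integral action N b \<beta>) {0..b}"
      using intF[OF lagrangian_continuous[OF L]] intF[OF lagrangian_continuous[OF N]]
      by (simp_all add: action_def v_def integrable_integral)
    have "((\<lambda>t. L (v t) - L X - N (v t) + N X) has_integral
        action L b \<beta> - b * L X - action N b \<beta> + b * N X) {0..b}"
      using b has_integral_const_real[of "L X" 0 b] has_integral_const_real[of "N X" 0 b]
      by (intro has_integral_add has_integral_diff iL iN) auto
    then have "integral {0..b} (\<lambda>t. f (v t)) = action L b \<beta> - b * L X - action N b \<beta> + b * N X"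
      unfolding f_def by (rule integral_unique)
    moreover have "b * N X \<le> action N b \<beta>"
      using action_lower_bound[OF N b \<beta> U Q V m z] by (simp add: LX[OF N])
    ultimately show ?thesis using min by (simp add: LX[OF L])
  qed
  have "((\<lambda>t. (norm (v t))\<^sup>2) has_integral b * (norm X)\<^sup>2) {0..b}"
    using pw
  proof (induction rule: piecewise_C1_induct)
    case base
    show ?case using has_integral_refl(2)[of _ "0::real"] by simp
  next
    case (step c d D)
    have "integral {c..d} (\<lambda>t. f (D t)) = integral {c..d} (\<lambda>t. f (v t))"
      using piece_integral[OF step(1-4,6) f_cont] unfolding v_def by (simp add: integral_unique)
    also have "\<dots> \<le> integral {0..b} (\<lambda>t. f (v t))"
      using step(1-3) f_nonneg intF[OF f_cont]
      by (intro integral_subset_le) (auto intro: integrable_subinterval_real)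
    finally have "integral {c..d} (\<lambda>t. f (D t)) \<le> 0" using total by simp
    moreover have fD: "continuous_on {c..d} (\<lambda>t. f (D t))"
      using continuous_on_compose2[OF f_cont step(4)] by simp
    then have "0 \<le> integral {c..d} (\<lambda>t. f (D t))"
      using f_nonneg by (intro integral_nonneg integrable_continuous_interval) auto
    ultimately have "integral {c..d} (\<lambda>t. f (D t)) = 0" by simp
    then have f0: "f (D t) = 0" if "t \<in> {c..d}" for t
      using integral_eq_0_iff[OF fD step(2)] f_nonneg that by blast
    have speed: "norm (D t) = norm X" if t: "t \<in> {c..d}" for t
    proof -
      have un': "unitary (\<beta> s)" if "s \<in> {c..d}" for s
        using un that step(1,3) by auto
      obtain p where p: "\<And>j. 0 \<le> p j" "norm (D t) = norm (dg (\<chi> j. complex_of_real (p j)))"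
        "\<And>L. symmetric_lagrangian L \<Longrightarrow> L (D t) = L (dg (\<chi> j. complex_of_real (p j)))"
        using unitary_velocity[OF step(2) t un' step(5)[OF t]] by blast
      have "L (dg (\<chi> j. of_real (p j))) \<le> L X + orbit_sup W (dg (\<chi> j. of_real (p j))) - orbit_sup W X"
        using f0[OF t] p(3)[OF L] p(3)[OF N] by (simp add: f_def N_def)
      then have "norm (dg (\<chi> j. complex_of_real (p j))) = norm X"
        using touching_norm[OF L strict X_def w W_def sub' p(1) refl] by simp
      then show ?thesis using p(2) by simp
    qed
    have "((\<lambda>t. (norm (v t))\<^sup>2) has_integral integral {c..d} (\<lambda>t. (norm (D t))\<^sup>2)) {c..d}"
      unfolding v_def
      by (rule piece_integral[OF step(1-4,6)]) (assumption, intro continuous_intros)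
    moreover have "integral {c..d} (\<lambda>t. (norm (D t))\<^sup>2) = integral {c..d} (\<lambda>t. (norm X)\<^sup>2)"
      using speed by (intro integral_cong) simp
    ultimately have "((\<lambda>t. (norm (v t))\<^sup>2) has_integral (d - c) * (norm X)\<^sup>2) {c..d}"
      using step(2) by simp
    then have "((\<lambda>t. (norm (v t))\<^sup>2) has_integral c * (norm X)\<^sup>2 + (d - c) * (norm X)\<^sup>2) {0..d}"
      using step(1,2,7) by (intro has_integral_combine[of 0 c d]) auto
    then show ?case by (simp add: algebra_simps)
  qed
  moreover have "b * (norm X)\<^sup>2 = (\<Sum>j\<in>UNIV. (z j)\<^sup>2 / b)"
  proof -
    have "(norm X)\<^sup>2 = (\<Sum>j\<in>UNIV. (x j)\<^sup>2)"
      unfolding X_def norm_dg by (simp add: norm_vec_def L2_set_def sum_nonneg)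
    then show ?thesis
      using b by (simp add: x_def sum_distrib_left power_divide) (simp add: power2_eq_square)
  qed
  ultimately show ?thesis by (simp add: v_def)
qed

lemma piecewise_C1_derivative:
  assumes "piecewise_C1 f a b"
  obtains S where "finite S"
    "\<And>t. t \<in> {a<..<b} - S \<Longrightarrow> (f has_vector_derivative vector_derivative f (at t within {a..b})) (at t)"
proof -
  define v where "v t = vector_derivative f (at t within {a..b})" for t
  have "\<exists>S. finite S \<and> (\<forall>t\<in>{a<..<b} - S. (f has_vector_derivative v t) (at t))"
    using assms
  proof (induction rule: piecewise_C1_induct)
    case (step c d D)
    then obtain S where S: "finite S" "\<And>t. t \<in> {a<..<c} - S \<Longrightarrow> (f has_vector_derivative v t) (at t)"
      by blast
    have "(f has_vector_derivative v t) (at t)" if "t \<in> {a<..<d} - insert c S" for t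
    proof (cases "t < c")
      case False
      then have t: "t \<in> {c<..<d}" "a < t" "t < b" using that step(1-3) by auto
      then have "v t = D t"
        unfolding v_def using vector_derivative_at[OF step(6)] at_within_Icc_at[of a t b] by simp
      then show ?thesis using step(6)[OF t(1)] by simp
    qed (use S(2) that in auto)
    then show ?case using S(1) by (intro exI[of _ "insert c S"]) auto
  qed auto
  then show ?thesis using that unfolding v_def by blast
qed

lemma inner_cis_scale: "(cis x *s u) \<bullet> u = cos x * (norm u)\<^sup>2" for u :: "complex^'n"
  unfolding power2_norm_eq_inner inner_vec_def
  by (simp add: inner_complex_def sum_distrib_left) (simp add: algebra_simps)

theorem minimizer_unique:
  fixes L :: "complex^'n^'n \<Rightarrow> real"
  assumes L: "symmetric_lagrangian L" and strict: "strictly_convex_lagrangian L" and b: "0 < b"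
    and \<beta>: "unitary_curve b U V \<beta>" and U: "unitary U" and Q: "unitary Q"
    and V: "V = U ** (Q ** dg (\<chi> j. cis (z j)) ** ctranspose Q)"
    and m: "0 \<le> m" "m < pi" and z: "\<And>j. \<bar>z j\<bar> \<le> m"
    and min: "action L b \<beta> \<le> b * L (dg (\<chi> j. of_real (z j)) /\<^sub>R b)"
    and t: "t \<in> {0..b}"
  shows "\<beta> t = U ** (Q ** dg (\<chi> j. cis (t * (z j / b))) ** ctranspose Q)"
proof (cases "t = 0 \<or> t = b")
  \<comment> \<open>The end points are settled by the boundary values, because the penalty in
    \<open>sphere_angles_rigid\<close> needs \<open>t\<close> strictly inside the interval.\<close>
  case True
  then show ?thesis
    using \<beta> V Q b by (auto simp: unitary_curve_def dg_one unitary_def)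
next
  case False
  with t have t': "0 < t" "t < b" by auto
  define v where "v t = vector_derivative \<beta> (at t within {0..b})" for t
  define \<xi> where "\<xi> j = column j Q" for j
  define c where "c j t = \<beta> t *v \<xi> j" for j t
  define c' where "c' j t = v t *v \<xi> j" for j t
  have pw: "piecewise_C1 \<beta> 0 b" and un: "\<And>t. t \<in> {0..b} \<Longrightarrow> unitary (\<beta> t)"
    and ends: "\<beta> 0 = U" "\<beta> b = V"
    using \<beta> by (auto simp: unitary_curve_def)
  have col: "(A *v \<xi> j) $ i = (A ** Q) $ i $ j" for A :: "complex^'n^'n" and i j
    by (simp add: \<xi>_def column_def matrix_vector_mult_def matrix_mult_nth)
  have bl: "bounded_linear (\<lambda>A :: complex^'n^'n. A *v y)" for y
    by (intro linear_conv_bounded_linear[THEN iffD1] linearI)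
      (simp_all add: matrix_vector_mult_add_rdistrib scaleR_vector)
  obtain S where S: "finite S" "\<And>t. t \<in> {0<..<b} - S \<Longrightarrow> (\<beta> has_vector_derivative v t) (at t)"
    using piecewise_C1_derivative[OF pw] unfolding v_def by blast
  have deriv: "(c j has_vector_derivative c' j x) (at x)" if "x \<in> {0<..<b} - S" for j x
    unfolding c_def[abs_def] c'_def by (rule bounded_linear.has_vector_derivative[OF bl S(2)[OF that]])
  have cont: "continuous_on {0..b} (c j)" for j
    unfolding c_def[abs_def] using pw
    by (intro bounded_linear.continuous_on[OF bl]) (simp add: piecewise_C1_def)
  have c1: "norm (c j x) = 1" if "x \<in> {0..b}" for j x
  proof -
    have "unitary (ctranspose (\<beta> x ** Q))"
      by (intro unitary_ctranspose unitary_mult un that Q)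
    then have "(\<Sum>i\<in>UNIV. (norm ((\<beta> x ** Q) $ i $ j))\<^sup>2) = 1"
      using unitary_row[of "ctranspose (\<beta> x ** Q)" j] by simp
    then show ?thesis
      by (simp add: norm_vec_def L2_set_def c_def col)
  qed
  have int: "(\<lambda>x. (norm (c' j x))\<^sup>2) integrable_on {0..b}" for j
    unfolding c'_def v_def
    by (rule speed_integrable[OF pw])
      (intro continuous_intros linear_continuous_on bl)
  \<comment> \<open>The columns of \<open>Q\<close> are orthonormal, so the squared speeds of the
    curves \<open>c j\<close> add up to the squared Frobenius speed of
    \<open>\<beta>\<close>.\<close>
  have energy: "(\<Sum>j\<in>UNIV. integral {0..b} (\<lambda>x. (norm (c' j x))\<^sup>2)) = (\<Sum>j\<in>UNIV. (z j)\<^sup>2 / b)"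
  proof -
    have "(\<Sum>j\<in>UNIV. (norm (c' j x))\<^sup>2) = (norm (v x))\<^sup>2" for x
    proof -
      have "(\<Sum>j\<in>UNIV. (norm (c' j x))\<^sup>2) = (\<Sum>j\<in>UNIV. \<Sum>i\<in>UNIV. (norm ((v x ** Q) $ i $ j))\<^sup>2)"
        by (simp add: norm_vec_def L2_set_def c'_def col sum_nonneg)
      also have "\<dots> = (norm (v x ** Q))\<^sup>2"
        unfolding norm_matrix_sq by (rule sum.swap)
      finally show ?thesis by (simp add: norm_mult_unitary Q)
    qed
    then have "(\<Sum>j\<in>UNIV. integral {0..b} (\<lambda>x. (norm (c' j x))\<^sup>2)) = integral {0..b} (\<lambda>x. (norm (v x))\<^sup>2)"
      using int by (subst integral_sum[symmetric]) auto
    then show ?thesis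
      using minimizer_energy[OF L strict b \<beta> U Q V m z min] by (simp add: v_def integral_unique)
  qed
  have UQ: "c j 0 $ i = (U ** Q) $ i $ j" for i j
    by (simp add: c_def ends col)
  have cb: "c j b = cis (z j) *s c j 0" for j
  proof -
    have "V ** Q = U ** Q ** dg (\<chi> j. cis (z j))"
      unfolding V using unitary_cancel(4)[OF Q] by (simp add: matrix_mul_assoc)
    then have "c j b $ i = cis (z j) * c j 0 $ i" for i
      unfolding UQ by (simp add: c_def ends col mult.commute)
    then show ?thesis by (simp add: vec_eq_iff)
  qed
  have inb: "c j b \<bullet> c j 0 = cos \<bar>z j\<bar>" for j
    using c1[of 0 j] b by (simp add: cb inner_cis_scale)
  have self: "c j x \<bullet> c j x = 1" if "x \<in> {0..b}" for j x
    using c1[OF that] by (simp add: norm_eq_1)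
  have zpi: "\<bar>z j\<bar> < pi" for j using z[of j] m by linarith
  have acos: "arccos (c j b \<bullet> c j 0) = \<bar>z j\<bar>" "arccos (c j 0 \<bullet> c j b) = \<bar>z j\<bar>" for j
    using zpi[of j] inb[of j] by (simp_all add: inner_commute[of "c j 0"] arccos_cos less_imp_le del: cos_abs_real)
  have first: "c j 0 \<bullet> c j t = cos (t * (z j / b))" for j
  proof -
    have "arccos (c j 0 \<bullet> c j t) = arccos (c j 0 \<bullet> c j 0) + \<bar>z j\<bar> * t / b"
      by (rule sphere_angles_rigid[OF t' cont S(1) deriv c1 _ int, where u = "\<lambda>j. c j 0" and \<sigma> = "\<lambda>j. \<bar>z j\<bar>"])
        (use b energy in \<open>simp_all add: acos self c1\<close>)
    then have "arccos (c j 0 \<bullet> c j t) = \<bar>t * (z j / b)\<bar>"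
      using b t' by (simp add: self abs_mult mult.commute)
    moreover have "\<bar>c j 0 \<bullet> c j t\<bar> \<le> 1"
      using Cauchy_Schwarz_ineq2[of "c j 0" "c j t"] c1[of 0 j] c1[of t j] b t' by simp
    ultimately show ?thesis by (metis cos_arccos_abs cos_abs_real)
  qed
  \<comment> \<open>The distance from the end point decreases from \<open>\<bar>z j\<bar>\<close> to
    0, hence the negative \<open>\<sigma>\<close>; its square, and so the energy budget, is the same
    as for the starting point.\<close>
  have second: "c j b \<bullet> c j t = cos (z j - t * (z j / b))" for j
  proof -
    have "arccos (c j b \<bullet> c j t) = arccos (c j b \<bullet> c j 0) + - \<bar>z j\<bar> * t / b"
      by (rule sphere_angles_rigid[OF t' cont S(1) deriv c1 _ int, where u = "\<lambda>j. c j b" and \<sigma> = "\<lambda>j. - \<bar>z j\<bar>"])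
        (use b energy in \<open>simp_all add: acos self c1\<close>)
    also have "\<dots> = \<bar>z j\<bar> * (1 - t / b)"
      by (simp add: acos algebra_simps)
    also have "\<dots> = \<bar>z j * (1 - t / b)\<bar>"
      using b t' by (simp add: abs_mult)
    also have "z j * (1 - t / b) = z j - t * (z j / b)"
      by (simp add: algebra_simps)
    finally have "arccos (c j b \<bullet> c j t) = \<bar>z j - t * (z j / b)\<bar>" .
    moreover have "\<bar>c j b \<bullet> c j t\<bar> \<le> 1"
      using Cauchy_Schwarz_ineq2[of "c j b" "c j t"] c1[of b j] c1[of t j] b t' by simp
    ultimately show ?thesis by (metis cos_arccos_abs cos_abs_real)
  qed
  have "c j t = cis (t * (z j / b)) *s c j 0" for j
    using first second[of j] b t zpi
    by (intro great_circle_unique[of _ _ "z j"]) (auto simp: c1 cb)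
  then have "c j t $ i = cis (t * (z j / b)) * c j 0 $ i" for i j
    by simp
  then have "(\<beta> t ** Q) $ i $ j = cis (t * (z j / b)) * (U ** Q) $ i $ j" for i j
    unfolding UQ by (simp add: c_def col)
  then have "\<beta> t ** Q = U ** Q ** dg (\<chi> j. cis (t * (z j / b)))"
    by (simp add: vec_eq_iff mult.commute)
  then have "\<beta> t = U ** Q ** dg (\<chi> j. cis (t * (z j / b))) ** ctranspose Q"
    by (metis unitary_cancel(3)[OF Q])
  then show ?thesis by (simp add: matrix_mul_assoc)
qed

lemma eigenvalue_le_spectral_norm:
  assumes Q: "unitary Q" and Z: "Z = Q ** dg (\<chi> j. of_real (z j)) ** ctranspose Q"
  shows "\<bar>z j\<bar> \<le> spectral_norm Z"
proof -
  have "Z ** Q = Q ** dg (\<chi> j. of_real (z j))"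
    unfolding Z by (rule unitary_cancel(4)[OF Q])
  moreover have "(Z *v column j Q) $ i = (Z ** Q) $ i $ j" for i
    by (simp add: column_def matrix_vector_mult_def matrix_mult_nth)
  ultimately have "Z *v column j Q = z j *\<^sub>R column j Q"
    by (simp add: vec_eq_iff column_def) (simp add: scaleR_conv_of_real mult.commute)
  moreover have "norm (column j Q) = 1"
    using unitary_row[OF unitary_ctranspose[OF Q], of j]
    by (simp add: norm_vec_def L2_set_def column_def)
  ultimately show ?thesis
    using onorm[OF matrix_vector_mul_bounded_linear[of Z], of "column j Q"]
    by (simp add: spectral_norm_def)
qed

theorem theorem3p9:
  fixes L :: "complex^'n^'n \<Rightarrow> real"
    and b :: real
    and Z U V :: "complex^'n^'n"
    and \<gamma> :: "real \<Rightarrow> complex^'n^'n"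
  assumes "symmetric_lagrangian L"
    and "strictly_convex_lagrangian L"
    and "0 < b"
    and "hermitian Z"
    and "spectral_norm Z < pi"
    and "unitary U"
    and "V = U ** mexp (cscale \<i> Z)"
    and "\<gamma> = (\<lambda>t. U ** mexp (cscale (\<i> * complex_of_real (t / b)) Z))"
  shows "action_minimizer L b U V \<gamma>
    \<and> (\<forall>\<beta>. action_minimizer L b U V \<beta> \<longrightarrow> (\<forall>t\<in>{0..b}. \<beta> t = \<gamma> t))
    \<and> action L b \<gamma> = b * L (Z /\<^sub>R b)"
proof -
  note L = assms(1) and strict = assms(2) and b = assms(3) and U = assms(6)
  obtain Q d where Q: "unitary Q" and d: "\<And>i. d $ i \<in> \<real>" and "Z = Q ** dg d ** ctranspose Q"
    using hermitian_diagonalization[OF assms(4)] by blast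
  define z where "z j = Re (d $ j)" for j
  have "d = (\<chi> j. of_real (z j))"
    using d by (simp add: z_def vec_eq_iff)
  with \<open>Z = Q ** dg d ** ctranspose Q\<close> have Z: "Z = Q ** dg (\<chi> j. of_real (z j)) ** ctranspose Q"
    by simp
  \<comment> \<open>The spectral norm bounds all eigenvalue angles at once and stays below
    \<open>pi\<close>, so it can serve as the threshold up to which the angle function is
    exact.\<close>
  define m where "m = spectral_norm Z"
  have z: "\<bar>z j\<bar> \<le> m" for j
    unfolding m_def by (rule eigenvalue_le_spectral_norm[OF Q Z])
  have m: "0 \<le> m" "m < pi"
    using order_trans[OF abs_ge_zero z] assms(5) by (auto simp: m_def)
  have V: "V = U ** (Q ** dg (\<chi> j. cis (z j)) ** ctranspose Q)"
    using mexp_hermitian[OF Q Z, of 1] by (simp add: assms(7))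
  have \<gamma>: "\<gamma> = (\<lambda>t. U ** (Q ** dg (\<chi> j. cis (t * (z j / b))) ** ctranspose Q))"
    unfolding assms(8) mexp_hermitian[OF Q Z] by simp
  have curve: "unitary_curve b U V \<gamma>"
    using geodesic_unitary_curve[OF b U Q, of "\<lambda>j. z j / b"] b by (simp add: \<gamma> V)
  have scaled: "dg (\<chi> j. of_real (z j)) /\<^sub>R b = dg (\<chi> j. of_real (z j / b))"
    unfolding dg_scaleR[symmetric] dg_inject
    by (simp add: vec_eq_iff) (simp add: scaleR_conv_of_real field_simps)
  have LZ: "L (Z /\<^sub>R b) = L (dg (\<chi> j. of_real (z j)) /\<^sub>R b)"
    using lagrangian_conj[OF L Q, of "dg (\<chi> j. of_real (z j)) /\<^sub>R b"]
    by (simp add: Z matrix_mult_scaleR_left matrix_mult_scaleR_right)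
  have act: "action L b \<gamma> = b * L (dg (\<chi> j. of_real (z j)) /\<^sub>R b)"
    unfolding \<gamma> scaled by (rule geodesic_action[OF L b U Q])
  have minimizer: "action_minimizer L b U V \<gamma>"
    unfolding action_minimizer_def act
    using curve action_lower_bound[OF L b _ U Q V m z] by blast
  moreover have "\<beta> t = \<gamma> t" if "action_minimizer L b U V \<beta>" "t \<in> {0..b}" for \<beta> t
  proof -
    have "unitary_curve b U V \<beta>" "action L b \<beta> \<le> action L b \<gamma>"
      using that(1) curve by (auto simp: action_minimizer_def)
    then show ?thesis
      using minimizer_unique[OF L strict b _ U Q V m z _ that(2)] unfolding act by (simp only: \<gamma>)
  qed
  ultimately show ?thesis by (simp add: act LZ)
qed

end
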